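(* Let $(\mathcal{C},\mathcal{M})$ be an adhesive HLR category. For any set $\mathcal{R}$ of $\mathcal{M}$-weak spans and any objects $G,H$ of $\mathcal{C}$, any parallel coherent transformation $G\Vdash_{\mathcal{R}}H$ has a derived rule; that is, if $G\Vdash_{\mathcal{R}}H$ then there exists a span $\sigma$ in $\mathcal{C}$ such that $G\stackrel{\sigma}{\Longrightarrow}H$ and, for all objects $G',H'$ of $\mathcal{C}$, if $G'\stackrel{\sigma}{\Longrightarrow}H'$ then $G'\Vdash_{\mathcal{R}}H'$.
   Context: **Adhesive HLR category.** A pair $(\mathcal{C},\mathcal{M})$ of a category $\mathcal{C}$ and a class $\mathcal{M}$ of monomorphisms of $\mathcal{C}$ such that: (i) $\mathcal{M}$ contains all isomorphisms, is closed under composition and under decomposition ($g\circ f\in\mathcal{M}$ and $g\in\mathcal{M}$ imply $f\in\mathcal{M}$); (ii) $\mathcal{C}$ has pushouts and pullbacks along $\mathcal{M}$-morphisms (i.e., when at least one of the two given morphisms is in $\mathcal{M}$), and $\mathcal{M}$ is closed under pushouts and pullbacks (the morphism opposite to an $\mathcal{M}$-morphism in a pushout or pullback square is in $\mathcal{M}$); (iii) pushouts along $\mathcal{M}$-morphisms are Van Kampen squares: for every commutative cube having such a pushout as bottom face and whose two back faces are pullbacks, the top face is a pushout iff the two front faces are pullbacks. **Limits and colimits.** For morphisms $f_1:D_1\to G,\dots,f_p:D_p\to G$, a limit of $(f_1,\dots,f_p,G)$ is $(C,e_1,\dots,e_p)$ with $e_a:C\to D_a$ and $f_a\circ e_a=f_b\circ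 e_b$ for all $a,b$, such that for any other $(C',e_1',\dots,e_p')$ with $f_a\circ e'_a=f_b\circ e'_b$ for all $a,b$ there is a unique $u:C'\to C$ with $e_a'=e_a\circ u$ for all $a$. Colimits of $(C,s_1,\dots,s_p)$ with $s_a:C\to F_a$ are defined dually. Writing "$(g,n,H)$ is a pushout of $(I,r,d)$" means that $g\circ d=n\circ r$ is a pushout square with apex $I$ and corner $H$. **Weak spans.** A weak span $\rho$ is a diagram $L\xleftarrow{l}K\xleftarrow{i}I\xrightarrow{r}R$ in $\mathcal{C}$; it is an $\mathcal{M}$-weak span if $l,i,r\in\mathcal{M}$. Objects and morphisms of an indexed weak span or direct transformation carry the same index. **Direct transformations.** A direct transformation $\gamma$ of an object $G$ by $\rho$ consists of objects $D,H$ and morphisms $m:L\to G$, $k:K\to D$, $f:D\to G$, $g:D\to H$, $n:R\to H$ such that $f\circ k=m\circ l$ and $(g,n,H)$ is a pushout of $(I,r,k\circ i)$. If moreover $(f,m,G)$ is a pushout of $(K,l,k)$, $\gamma$ is a Weak Double-Pushout. $\Delta^{\mathrm{PO}}(G,\mathcal{R})$ is the set of all Weak Double-Pushouts of $G$ by elements of $\mathcal{R}$. **Parallel coherent diagrams and PCTs.** A parallel coherent diagram $\Gamma$ for $G$ is a commuting diagram constituted of direct transformations $\gamma_1,\dots,\gamma_p$ of $G$ by weak spans $\rho_1,\dots,\rho_p$ in $\mathcal{R}$ ($p\ge1$) and morphisms $j_a^b:I_a\to D_b$ for all $1\le a,b\le p$; thus $f_b\circ j_a^b=f_a\circ k_a\circ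 i_a$ for all $a,b$, and $j_a^a=k_a\circ i_a$. A parallel coherent transformation (PCT) of $G$ by $\Gamma$ consists of: a limit $(C,e_1,\dots,e_p)$ of $(f_1,\dots,f_p,G)$; for each $c$, the unique morphism $d_c:I_c\to C$ such that $j_c^a=e_a\circ d_c$ for all $a$; for each $a$, a pushout $(s_a,o_a,F_a)$ of $(I_a,r_a,d_a)$, with $s_a:C\to F_a$ and $o_a:R_a\to F_a$; and a colimit $(h_1,\dots,h_p,H)$ of $(C,s_1,\dots,s_p)$. If such data exist one writes $G\stackrel{\Gamma}{\Longrightarrow}H$. **The relation $\Vdash_{\mathcal{R}}$.** $G\Vdash_{\mathcal{R}}H$ means that there exists a parallel coherent diagram $\Gamma$ for $G$ whose direct transformations $\gamma_1,\dots,\gamma_p$ all belong to $\Delta^{\mathrm{PO}}(G,\mathcal{R})$ and such that $G\stackrel{\Gamma}{\Longrightarrow}H$. **Spans and derived rules.** For a span $\sigma = (L\xleftarrow{l}K\xrightarrow{r}R)$ in $\mathcal{C}$, $G\stackrel{\sigma}{\Longrightarrow}H$ means that there is a double-pushout diagram, i.e., an object $D$ and morphisms $m:L\to G$, $k:K\to D$, $n:R\to H$, $f:D\to G$, $g:D\to H$ such that $(f,m,G)$ is a pushout of $(K,l,k)$ and $(g,n,H)$ is a pushout of $(K,r,k)$. Given a binary relation $\vdash$ between objects of $\mathcal{C}$ and $G,H$ such that $G\vdash H$, a derived rule of $G\vdash H$ is a span $\sigma$ in $\mathcal{C}$ such that $G\stackrel{\sigma}{\Longrightarrow}H$ and for all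 objects $G',H'$ of $\mathcal{C}$, if $G'\stackrel{\sigma}{\Longrightarrow}H'$ then $G'\vdash H'$. *)

theory Defs
  imports Main
begin

record ('o, 'a) cat =
  Obj :: "'o set"
  Arr :: "'a set"
  Dom :: "'a \<Rightarrow> 'o"
  Cod :: "'a \<Rightarrow> 'o"
  Ident :: "'o \<Rightarrow> 'a"
  Comp :: "'a \<Rightarrow> 'a \<Rightarrow> 'a"  (infixl \<open>\<odot>\<index>\<close> 70)
  \<comment> \<open>\<open>g \<odot> f\<close> is "\<open>g\<close> after \<open>f\<close>"; only meaningful for composable arrows.\<close>

definition Hom :: "('o, 'a) cat \<Rightarrow> 'o \<Rightarrow> 'o \<Rightarrow> 'a set" where
  "Hom C A B = {f \<in> Arr C. Dom C f = A \<and> Cod C f = B}"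

locale category =
  fixes C :: "('o, 'a) cat" (structure)
  assumes Dom_in_Obj: "f \<in> Arr C \<Longrightarrow> Dom C f \<in> Obj C"
    and Cod_in_Obj: "f \<in> Arr C \<Longrightarrow> Cod C f \<in> Obj C"
    and Ident_in_Hom: "A \<in> Obj C \<Longrightarrow> Ident C A \<in> Hom C A A"
    and Comp_in_Hom: "\<lbrakk>f \<in> Hom C X Y; g \<in> Hom C Y Z\<rbrakk> \<Longrightarrow> g \<odot> f \<in> Hom C X Z"
    and Comp_Ident_right: "f \<in> Hom C X Y \<Longrightarrow> f \<odot> Ident C X = f"
    and Comp_Ident_left: "f \<in> Hom C X Y \<Longrightarrow> Ident C Y \<odot> f = f"
    and Comp_assoc: "\<lbrakk>f \<in> Hom C W X; g \<in> Hom C X Y; h \<in> Hom C Y Z\<rbrakk>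
          \<Longrightarrow> (h \<odot> g) \<odot> f = h \<odot> (g \<odot> f)"

definition is_mono :: "('o, 'a) cat \<Rightarrow> 'a \<Rightarrow> bool" where
  "is_mono C f \<longleftrightarrow> f \<in> Arr C \<and>
     (\<forall>X. \<forall>u \<in> Hom C X (Dom C f). \<forall>v \<in> Hom C X (Dom C f). f \<odot>\<^bsub>C\<^esub> u = f \<odot>\<^bsub>C\<^esub> v \<longrightarrow> u = v)"

definition is_iso :: "('o, 'a) cat \<Rightarrow> 'a \<Rightarrow> bool" where
  "is_iso C f \<longleftrightarrow> f \<in> Arr C \<and>
     (\<exists>g \<in> Hom C (Cod C f) (Dom C f).
        g \<odot>\<^bsub>C\<^esub> f = Ident C (Dom C f) \<and> f \<odot>\<^bsub>C\<^esub> g = Ident C (Cod C f))"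

text \<open>\<open>is_pushout C g n H I r d\<close>: \<open>(g, n, H)\<close> is a pushout of \<open>(I, r, d)\<close>, i.e.
  \<open>g \<odot> d = n \<odot> r\<close> is a pushout square with apex \<open>I\<close> and corner \<open>H\<close>. Thus \<open>g\<close> is opposite
  to \<open>r\<close> and \<open>n\<close> is opposite to \<open>d\<close>.\<close>

definition is_pushout ::
    "('o, 'a) cat \<Rightarrow> 'a \<Rightarrow> 'a \<Rightarrow> 'o \<Rightarrow> 'o \<Rightarrow> 'a \<Rightarrow> 'a \<Rightarrow> bool" where
  "is_pushout C g n H I r d \<longleftrightarrow>
     r \<in> Hom C I (Cod C r) \<and> d \<in> Hom C I (Cod C d) \<and>
     g \<in> Hom C (Cod C d) H \<and> n \<in> Hom C (Cod C r) H \<and>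
     g \<odot>\<^bsub>C\<^esub> d = n \<odot>\<^bsub>C\<^esub> r \<and>
     (\<forall>H'. \<forall>g' \<in> Hom C (Cod C d) H'. \<forall>n' \<in> Hom C (Cod C r) H'.
        g' \<odot>\<^bsub>C\<^esub> d = n' \<odot>\<^bsub>C\<^esub> r \<longrightarrow>
        (\<exists>!u. u \<in> Hom C H H' \<and> g' = u \<odot>\<^bsub>C\<^esub> g \<and> n' = u \<odot>\<^bsub>C\<^esub> n))"

text \<open>\<open>is_pullback C P p q f g Z\<close>: \<open>(P, p, q)\<close> is a pullback of \<open>(f, g, Z)\<close>, i.e.
  \<open>f \<odot> p = g \<odot> q\<close> is a pullback square. Thus \<open>q\<close> is opposite to \<open>f\<close> and \<open>p\<close> to \<open>g\<close>.\<close>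

definition is_pullback ::
    "('o, 'a) cat \<Rightarrow> 'o \<Rightarrow> 'a \<Rightarrow> 'a \<Rightarrow> 'a \<Rightarrow> 'a \<Rightarrow> 'o \<Rightarrow> bool" where
  "is_pullback C P p q f g Z \<longleftrightarrow>
     f \<in> Hom C (Dom C f) Z \<and> g \<in> Hom C (Dom C g) Z \<and>
     p \<in> Hom C P (Dom C f) \<and> q \<in> Hom C P (Dom C g) \<and>
     f \<odot>\<^bsub>C\<^esub> p = g \<odot>\<^bsub>C\<^esub> q \<and>
     (\<forall>P'. \<forall>p' \<in> Hom C P' (Dom C f). \<forall>q' \<in> Hom C P' (Dom C g).
        f \<odot>\<^bsub>C\<^esub> p' = g \<odot>\<^bsub>C\<^esub> q' \<longrightarrow>
        (\<exists>!u. u \<in> Hom C P' P \<and> p' = p \<odot>\<^bsub>C\<^esub> u \<and> q' = q \<odot>\<^bsub>C\<^esub> u))"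

text \<open>The bottom face \<open>f \<odot> b = g \<odot> c\<close> has apex \<open>W\<close>, corner \<open>Z\<close> and sides \<open>b : W \<rightarrow> X\<close>,
  \<open>c : W \<rightarrow> Y\<close>. The top face consists of the primed arrows, and \<open>w, x, y, z\<close> are the vertical
  arrows from \<open>W', X', Y', Z'\<close> to \<open>W, X, Y, Z\<close>. The back faces are those containing \<open>w\<close>.\<close>

definition is_van_kampen ::
    "('o, 'a) cat \<Rightarrow> 'a \<Rightarrow> 'a \<Rightarrow> 'o \<Rightarrow> 'o \<Rightarrow> 'a \<Rightarrow> 'a \<Rightarrow> bool" where
  "is_van_kampen C f g Z W c b \<longleftrightarrow>
     is_pushout C f g Z W c b \<and>
     (\<forall>W' X' Y' Z' b' c' f' g' w x y z.
        b' \<in> Hom C W' X' \<and> c' \<in> Hom C W' Y' \<and> f' \<in> Hom C X' Z' \<and> g' \<in> Hom C Y' Z' \<and>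
        w \<in> Hom C W' W \<and> x \<in> Hom C X' (Cod C b) \<and> y \<in> Hom C Y' (Cod C c) \<and> z \<in> Hom C Z' Z \<and>
        f' \<odot>\<^bsub>C\<^esub> b' = g' \<odot>\<^bsub>C\<^esub> c' \<and>
        z \<odot>\<^bsub>C\<^esub> f' = f \<odot>\<^bsub>C\<^esub> x \<and> z \<odot>\<^bsub>C\<^esub> g' = g \<odot>\<^bsub>C\<^esub> y \<and>
        is_pullback C W' w b' b x (Cod C b) \<and> is_pullback C W' w c' c y (Cod C c) \<longrightarrow>
        (is_pushout C f' g' Z' W' c' b' \<longleftrightarrow>
         is_pullback C X' x f' f z Z \<and> is_pullback C Y' y g' g z Z))"

text \<open>Pushout and pullback squares are symmetric in their two legs, so it is enough to let a
  fixed one of the two given arrows be in \<open>M\<close>.\<close>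

locale adhesive_hlr = category C for C :: "('o, 'a) cat" (structure) +
  fixes M :: "'a set"
  assumes M_mono: "f \<in> M \<Longrightarrow> is_mono C f"
    and M_iso: "is_iso C f \<Longrightarrow> f \<in> M"
    and M_comp: "\<lbrakk>f \<in> Hom C X Y; g \<in> Hom C Y Z; f \<in> M; g \<in> M\<rbrakk> \<Longrightarrow> g \<odot> f \<in> M"
    and M_decomp: "\<lbrakk>f \<in> Hom C X Y; g \<in> Hom C Y Z; g \<odot> f \<in> M; g \<in> M\<rbrakk> \<Longrightarrow> f \<in> M"
    and pushout_exists: "\<lbrakk>r \<in> Hom C I R; d \<in> Hom C I D; r \<in> M\<rbrakk>
          \<Longrightarrow> \<exists>g n H. is_pushout C g n H I r d"
    and pullback_exists: "\<lbrakk>f \<in> Hom C X Z; g \<in> Hom C Y Z; f \<in> M\<rbrakk>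
          \<Longrightarrow> \<exists>P p q. is_pullback C P p q f g Z"
    and M_pushout: "\<lbrakk>is_pushout C g n H I r d; r \<in> M\<rbrakk> \<Longrightarrow> g \<in> M"
    and M_pullback: "\<lbrakk>is_pullback C P p q f g Z; f \<in> M\<rbrakk> \<Longrightarrow> q \<in> M"
    and M_van_kampen: "\<lbrakk>is_pushout C g n H I r d; r \<in> M\<rbrakk> \<Longrightarrow> is_van_kampen C g n H I r d"

text \<open>Limits of \<open>(f\<^sub>1, \<dots>, f\<^sub>p, G)\<close> with \<open>f\<^sub>a : D\<^sub>a \<rightarrow> G\<close>, and dually colimits of
  \<open>(X, s\<^sub>1, \<dots>, s\<^sub>p)\<close> with \<open>s\<^sub>a : X \<rightarrow> F\<^sub>a\<close>. Values of the families outside \<open>{1..p}\<close> are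
  irrelevant.\<close>

definition is_limit ::
    "('o, 'a) cat \<Rightarrow> nat \<Rightarrow> (nat \<Rightarrow> 'o) \<Rightarrow> (nat \<Rightarrow> 'a) \<Rightarrow> 'o \<Rightarrow> 'o \<Rightarrow> (nat \<Rightarrow> 'a) \<Rightarrow> bool" where
  "is_limit C p D f G X e \<longleftrightarrow>
     G \<in> Obj C \<and> X \<in> Obj C \<and>
     (\<forall>a \<in> {1..p}. f a \<in> Hom C (D a) G) \<and>
     (\<forall>a \<in> {1..p}. e a \<in> Hom C X (D a)) \<and>
     (\<forall>a \<in> {1..p}. \<forall>b \<in> {1..p}. f a \<odot>\<^bsub>C\<^esub> e a = f b \<odot>\<^bsub>C\<^esub> e b) \<and>
     (\<forall>X' \<in> Obj C. \<forall>e'.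
        (\<forall>a \<in> {1..p}. e' a \<in> Hom C X' (D a)) \<and>
        (\<forall>a \<in> {1..p}. \<forall>b \<in> {1..p}. f a \<odot>\<^bsub>C\<^esub> e' a = f b \<odot>\<^bsub>C\<^esub> e' b) \<longrightarrow>
        (\<exists>!u. u \<in> Hom C X' X \<and> (\<forall>a \<in> {1..p}. e' a = e a \<odot>\<^bsub>C\<^esub> u)))"

definition is_colimit ::
    "('o, 'a) cat \<Rightarrow> nat \<Rightarrow> 'o \<Rightarrow> (nat \<Rightarrow> 'a) \<Rightarrow> (nat \<Rightarrow> 'o) \<Rightarrow> (nat \<Rightarrow> 'a) \<Rightarrow> 'o \<Rightarrow> bool" where
  "is_colimit C p X s F h H \<longleftrightarrow>
     X \<in> Obj C \<and> H \<in> Obj C \<and>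
     (\<forall>a \<in> {1..p}. s a \<in> Hom C X (F a)) \<and>
     (\<forall>a \<in> {1..p}. h a \<in> Hom C (F a) H) \<and>
     (\<forall>a \<in> {1..p}. \<forall>b \<in> {1..p}. h a \<odot>\<^bsub>C\<^esub> s a = h b \<odot>\<^bsub>C\<^esub> s b) \<and>
     (\<forall>H' \<in> Obj C. \<forall>h'.
        (\<forall>a \<in> {1..p}. h' a \<in> Hom C (F a) H') \<and>
        (\<forall>a \<in> {1..p}. \<forall>b \<in> {1..p}. h' a \<odot>\<^bsub>C\<^esub> s a = h' b \<odot>\<^bsub>C\<^esub> s b) \<longrightarrow>
        (\<exists>!u. u \<in> Hom C H H' \<and> (\<forall>a \<in> {1..p}. h' a = u \<odot>\<^bsub>C\<^esub> h a)))"

record ('o, 'a) weak_span =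
  ws_L :: 'o
  ws_K :: 'o
  ws_I :: 'o
  ws_R :: 'o
  ws_l :: 'a
  ws_i :: 'a
  ws_r :: 'a

definition is_weak_span :: "('o, 'a) cat \<Rightarrow> ('o, 'a) weak_span \<Rightarrow> bool" where
  "is_weak_span C \<rho> \<longleftrightarrow>
     ws_l \<rho> \<in> Hom C (ws_K \<rho>) (ws_L \<rho>) \<and>
     ws_i \<rho> \<in> Hom C (ws_I \<rho>) (ws_K \<rho>) \<and>
     ws_r \<rho> \<in> Hom C (ws_I \<rho>) (ws_R \<rho>)"

definition is_M_weak_span :: "('o, 'a) cat \<Rightarrow> 'a set \<Rightarrow> ('o, 'a) weak_span \<Rightarrow> bool" where
  "is_M_weak_span C M \<rho> \<longleftrightarrow>
     is_weak_span C \<rho> \<and> ws_l \<rho> \<in> M \<and> ws_i \<rho> \<in> M \<and> ws_r \<rho> \<in> M"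

record ('o, 'a) direct_transformation =
  dt_rule :: "('o, 'a) weak_span"
  dt_D :: 'o
  dt_H :: 'o
  dt_m :: 'a
  dt_k :: 'a
  dt_f :: 'a
  dt_g :: 'a
  dt_n :: 'a

definition is_direct_transformation ::
    "('o, 'a) cat \<Rightarrow> 'o \<Rightarrow> ('o, 'a) direct_transformation \<Rightarrow> bool" where
  "is_direct_transformation C G \<gamma> \<longleftrightarrow>
     (let \<rho> = dt_rule \<gamma> in
       is_weak_span C \<rho> \<and>
       dt_m \<gamma> \<in> Hom C (ws_L \<rho>) G \<and>
       dt_k \<gamma> \<in> Hom C (ws_K \<rho>) (dt_D \<gamma>) \<and>
       dt_f \<gamma> \<in> Hom C (dt_D \<gamma>) G \<and>
       dt_g \<gamma> \<in> Hom C (dt_D \<gamma>) (dt_H \<gamma>) \<and>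
       dt_n \<gamma> \<in> Hom C (ws_R \<rho>) (dt_H \<gamma>) \<and>
       dt_f \<gamma> \<odot>\<^bsub>C\<^esub> dt_k \<gamma> = dt_m \<gamma> \<odot>\<^bsub>C\<^esub> ws_l \<rho> \<and>
       is_pushout C (dt_g \<gamma>) (dt_n \<gamma>) (dt_H \<gamma>) (ws_I \<rho>) (ws_r \<rho>) (dt_k \<gamma> \<odot>\<^bsub>C\<^esub> ws_i \<rho>))"

definition is_weak_double_pushout ::
    "('o, 'a) cat \<Rightarrow> 'o \<Rightarrow> ('o, 'a) direct_transformation \<Rightarrow> bool" where
  "is_weak_double_pushout C G \<gamma> \<longleftrightarrow>
     is_direct_transformation C G \<gamma> \<and>
     is_pushout C (dt_f \<gamma>) (dt_m \<gamma>) G (ws_K (dt_rule \<gamma>)) (ws_l (dt_rule \<gamma>)) (dt_k \<gamma>)"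

definition Delta_PO ::
    "('o, 'a) cat \<Rightarrow> 'o \<Rightarrow> ('o, 'a) weak_span set \<Rightarrow> ('o, 'a) direct_transformation set" where
  "Delta_PO C G \<R> = {\<gamma>. dt_rule \<gamma> \<in> \<R> \<and> is_weak_double_pushout C G \<gamma>}"

text \<open>\<open>pcd_j \<Gamma> a b\<close> is the arrow \<open>j\<^sub>a\<^sup>b : I\<^sub>a \<rightarrow> D\<^sub>b\<close>.\<close>

record ('o, 'a) pc_diagram =
  pcd_p :: nat
  pcd_gamma :: "nat \<Rightarrow> ('o, 'a) direct_transformation"
  pcd_j :: "nat \<Rightarrow> nat \<Rightarrow> 'a"

definition is_pc_diagram ::
    "('o, 'a) cat \<Rightarrow> ('o, 'a) weak_span set \<Rightarrow> 'o \<Rightarrow> ('o, 'a) pc_diagram \<Rightarrow> bool" where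
  "is_pc_diagram C \<R> G \<Gamma> \<longleftrightarrow>
     (let p = pcd_p \<Gamma>; \<gamma> = pcd_gamma \<Gamma>; j = pcd_j \<Gamma>; \<rho> = (\<lambda>a. dt_rule (\<gamma> a)) in
       1 \<le> p \<and>
       (\<forall>a \<in> {1..p}. \<rho> a \<in> \<R> \<and> is_direct_transformation C G (\<gamma> a)) \<and>
       (\<forall>a \<in> {1..p}. \<forall>b \<in> {1..p}. j a b \<in> Hom C (ws_I (\<rho> a)) (dt_D (\<gamma> b))) \<and>
       (\<forall>a \<in> {1..p}. \<forall>b \<in> {1..p}.
          dt_f (\<gamma> b) \<odot>\<^bsub>C\<^esub> j a b = dt_f (\<gamma> a) \<odot>\<^bsub>C\<^esub> dt_k (\<gamma> a) \<odot>\<^bsub>C\<^esub> ws_i (\<rho> a)) \<and>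
       (\<forall>a \<in> {1..p}. j a a = dt_k (\<gamma> a) \<odot>\<^bsub>C\<^esub> ws_i (\<rho> a)))"

text \<open>\<open>is_pct C G \<Gamma> H\<close> renders \<open>G \<Longrightarrow> H\<close> by \<open>\<Gamma>\<close>. The arrows \<open>d\<^sub>c\<close> required below are unique (and
  exist) by the universal property of the limit, since \<open>f\<^sub>a \<odot> j\<^sub>c\<^sup>a\<close> does not depend on \<open>a\<close>. The
  object \<open>C\<close> of the usual notation is here called \<open>X\<close>, and \<open>o\<^sub>a\<close> is called \<open>q\<^sub>a\<close>.\<close>

definition is_pct :: "('o, 'a) cat \<Rightarrow> 'o \<Rightarrow> ('o, 'a) pc_diagram \<Rightarrow> 'o \<Rightarrow> bool" where
  "is_pct C G \<Gamma> H \<longleftrightarrow>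
     (let p = pcd_p \<Gamma>; \<gamma> = pcd_gamma \<Gamma>; j = pcd_j \<Gamma>; \<rho> = (\<lambda>a. dt_rule (\<gamma> a)) in
       \<exists>X e d s q F h.
         is_limit C p (\<lambda>a. dt_D (\<gamma> a)) (\<lambda>a. dt_f (\<gamma> a)) G X e \<and>
         (\<forall>c \<in> {1..p}. d c \<in> Hom C (ws_I (\<rho> c)) X \<and> (\<forall>a \<in> {1..p}. j c a = e a \<odot>\<^bsub>C\<^esub> d c)) \<and>
         (\<forall>a \<in> {1..p}. is_pushout C (s a) (q a) (F a) (ws_I (\<rho> a)) (ws_r (\<rho> a)) (d a)) \<and>
         is_colimit C p X s F h H)"

definition pct_rel :: "('o, 'a) cat \<Rightarrow> ('o, 'a) weak_span set \<Rightarrow> 'o \<Rightarrow> 'o \<Rightarrow> bool" where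
  "pct_rel C \<R> G H \<longleftrightarrow>
     (\<exists>\<Gamma>. is_pc_diagram C \<R> G \<Gamma> \<and>
        (\<forall>a \<in> {1..pcd_p \<Gamma>}. pcd_gamma \<Gamma> a \<in> Delta_PO C G \<R>) \<and>
        is_pct C G \<Gamma> H)"

record ('o, 'a) span =
  sp_L :: 'o
  sp_K :: 'o
  sp_R :: 'o
  sp_l :: 'a
  sp_r :: 'a

definition is_span :: "('o, 'a) cat \<Rightarrow> ('o, 'a) span \<Rightarrow> bool" where
  "is_span C \<sigma> \<longleftrightarrow>
     sp_l \<sigma> \<in> Hom C (sp_K \<sigma>) (sp_L \<sigma>) \<and> sp_r \<sigma> \<in> Hom C (sp_K \<sigma>) (sp_R \<sigma>)"

definition dpo_rel :: "('o, 'a) cat \<Rightarrow> ('o, 'a) span \<Rightarrow> 'o \<Rightarrow> 'o \<Rightarrow> bool" where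
  "dpo_rel C \<sigma> G H \<longleftrightarrow>
     (\<exists>D m k n f g.
        m \<in> Hom C (sp_L \<sigma>) G \<and> k \<in> Hom C (sp_K \<sigma>) D \<and> n \<in> Hom C (sp_R \<sigma>) H \<and>
        f \<in> Hom C D G \<and> g \<in> Hom C D H \<and>
        is_pushout C f m G (sp_K \<sigma>) (sp_l \<sigma>) k \<and>
        is_pushout C g n H (sp_K \<sigma>) (sp_r \<sigma>) k)"

definition is_derived_rule ::
    "('o, 'a) cat \<Rightarrow> ('o \<Rightarrow> 'o \<Rightarrow> bool) \<Rightarrow> 'o \<Rightarrow> 'o \<Rightarrow> ('o, 'a) span \<Rightarrow> bool" where
  "is_derived_rule C rel G H \<sigma> \<longleftrightarrow>
     is_span C \<sigma> \<and> dpo_rel C \<sigma> G H \<and>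
     (\<forall>G' \<in> Obj C. \<forall>H' \<in> Obj C. dpo_rel C \<sigma> G' H' \<longrightarrow> rel G' H')"

end

theory Submission
  imports Defs
begin

text \<open>The derived rule is the span \<open>G \<leftarrow> X \<rightarrow> H\<close>, where \<open>X\<close> is the limit (intersection) of the
  \<open>D\<^sub>a \<rightarrow> G\<close>. Given a double pushout of \<open>G'\<close> by it with pushout complement \<open>D'\<close>, let \<open>B\<^sub>a\<close> be the
  pushout of \<open>D\<^sub>a \<leftarrow> X \<rightarrow> D'\<close>. Pasting pushouts makes each \<open>B\<^sub>a \<rightarrow> G'\<close> a weak double pushout by the
  same rule, and \<open>H'\<close> the colimit of the pushed out \<open>F\<^sub>a\<close>. The point where adhesivity is
  needed is that \<open>D'\<close> is again the limit of the \<open>B\<^sub>a \<rightarrow> G'\<close>, that is, that finite intersections of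
  \<open>\<M>\<close>-subobjects are stable under pushout.\<close>

section \<open>Arrows and the universal properties of pushouts and pullbacks\<close>

context category
begin

lemma Hom_Obj:
  assumes "f \<in> Hom C X Y" shows "X \<in> Obj C" "Y \<in> Obj C"
  using assms Dom_in_Obj Cod_in_Obj unfolding Hom_def by auto

lemma Hom_DomCod:
  assumes "f \<in> Hom C X Y" shows "Dom C f = X" "Cod C f = Y" "f \<in> Arr C"
  using assms unfolding Hom_def by auto

lemma mono_cancel:
  assumes "is_mono C f" "f \<in> Hom C Y Z" "u \<in> Hom C X Y" "v \<in> Hom C X Y" "f \<odot> u = f \<odot> v"
  shows "u = v"
  using assms Hom_DomCod unfolding is_mono_def by metis

lemma is_pushoutI:
  assumes "r \<in> Hom C I R" "d \<in> Hom C I D" "g \<in> Hom C D H" "n \<in> Hom C R H"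
    and "g \<odot> d = n \<odot> r"
    and "\<And>H' g' n'. \<lbrakk>g' \<in> Hom C D H'; n' \<in> Hom C R H'; g' \<odot> d = n' \<odot> r\<rbrakk>
          \<Longrightarrow> \<exists>u. u \<in> Hom C H H' \<and> g' = u \<odot> g \<and> n' = u \<odot> n"
    and "\<And>H' u v. \<lbrakk>u \<in> Hom C H H'; v \<in> Hom C H H'; u \<odot> g = v \<odot> g; u \<odot> n = v \<odot> n\<rbrakk> \<Longrightarrow> u = v"
  shows "is_pushout C g n H I r d"
  unfolding is_pushout_def Hom_DomCod[OF assms(1)] Hom_DomCod[OF assms(2)]
proof (intro conjI allI ballI impI)
  fix H' g' n'
  assume "g' \<in> Hom C D H'" "n' \<in> Hom C R H'" "g' \<odot> d = n' \<odot> r"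
  then show "\<exists>!u. u \<in> Hom C H H' \<and> g' = u \<odot> g \<and> n' = u \<odot> n"
    using assms(6)[of g' H' n'] assms(7)[of _ H'] by metis
qed (use assms(1-5) in auto)

lemma pushout_arrows:
  assumes "is_pushout C g n H I r d" "r \<in> Hom C I R" "d \<in> Hom C I D"
  shows "g \<in> Hom C D H" "n \<in> Hom C R H" "g \<odot> d = n \<odot> r"
  using assms Hom_DomCod unfolding is_pushout_def by metis+

lemma pushout_ex1:
  assumes "is_pushout C g n H I r d" "r \<in> Hom C I R" "d \<in> Hom C I D"
    and "g' \<in> Hom C D H'" "n' \<in> Hom C R H'" "g' \<odot> d = n' \<odot> r"
  shows "\<exists>!u. u \<in> Hom C H H' \<and> g' = u \<odot> g \<and> n' = u \<odot> n"
  using assms(1,4-6)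
  unfolding is_pushout_def Hom_DomCod[OF assms(2)] Hom_DomCod[OF assms(3)] by blast

text \<open>Both arrows mediate the cocone formed by \<open>u \<odot> g\<close> and
  \<open>u \<odot> n\<close>, so uniqueness identifies them: the two legs of a pushout are jointly
  epic.\<close>

lemma pushout_ext:
  assumes "is_pushout C g n H I r d" "r \<in> Hom C I R" "d \<in> Hom C I D"
    and "u \<in> Hom C H H'" "v \<in> Hom C H H'" "u \<odot> g = v \<odot> g" "u \<odot> n = v \<odot> n"
  shows "u = v"
proof -
  note a = pushout_arrows[OF assms(1-3)]
  have "(u \<odot> g) \<odot> d = (u \<odot> n) \<odot> r"
    using Comp_assoc[OF assms(3) a(1) assms(4)] Comp_assoc[OF assms(2) a(2) assms(4)] a(3) by simp
  then show ?thesis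
    using pushout_ex1[OF assms(1-3) Comp_in_Hom[OF a(1) assms(4)] Comp_in_Hom[OF a(2) assms(4)]]
      assms(4-7) by metis
qed

lemma is_pullbackI:
  assumes "f \<in> Hom C X Z" "g \<in> Hom C Y Z" "p \<in> Hom C P X" "q \<in> Hom C P Y"
    and "f \<odot> p = g \<odot> q"
    and "\<And>P' p' q'. \<lbrakk>p' \<in> Hom C P' X; q' \<in> Hom C P' Y; f \<odot> p' = g \<odot> q'\<rbrakk>
          \<Longrightarrow> \<exists>!u. u \<in> Hom C P' P \<and> p' = p \<odot> u \<and> q' = q \<odot> u"
  shows "is_pullback C P p q f g Z"
  unfolding is_pullback_def Hom_DomCod[OF assms(1)] Hom_DomCod[OF assms(2)]
  using assms by auto

lemma pullback_arrows:
  assumes "is_pullback C P p q f g Z" "f \<in> Hom C X Z" "g \<in> Hom C Y Z"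
  shows "p \<in> Hom C P X" "q \<in> Hom C P Y" "f \<odot> p = g \<odot> q"
  using assms Hom_DomCod unfolding is_pullback_def by metis+

lemma pullback_ex1:
  assumes "is_pullback C P p q f g Z" "f \<in> Hom C X Z" "g \<in> Hom C Y Z"
    and "p' \<in> Hom C P' X" "q' \<in> Hom C P' Y" "f \<odot> p' = g \<odot> q'"
  shows "\<exists>!u. u \<in> Hom C P' P \<and> p' = p \<odot> u \<and> q' = q \<odot> u"
  using assms(1,4-6)
  unfolding is_pullback_def Hom_DomCod[OF assms(2)] Hom_DomCod[OF assms(3)] by blast

section \<open>Degenerate squares\<close>

lemma pullback_Ident:
  assumes k: "k \<in> Hom C X Y"
  shows "is_pullback C X (Ident C X) k k (Ident C Y) Y"
proof -
  note O = Hom_Obj[OF k]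
  show ?thesis
    by (rule is_pullbackI[OF k Ident_in_Hom[OF O(2)] Ident_in_Hom[OF O(1)] k])
      (use Comp_Ident_left Comp_Ident_right k in metis)+
qed

text \<open>Cancelling \<open>z\<close> in \<open>(z \<odot> d) \<odot> p' = z \<odot> q'\<close>
  leaves \<open>q' = d \<odot> p'\<close>, so \<open>p'\<close> alone determines the mediating
  arrow. With \<open>d\<close> an identity this is the kernel pair of a monomorphism.\<close>

lemma pullback_mono:
  assumes z: "z \<in> Hom C E Z" "is_mono C z" and d: "d \<in> Hom C D E"
  shows "is_pullback C D (Ident C D) d (z \<odot> d) z Z"
proof -
  note O = Hom_Obj[OF d]
  show ?thesis
  proof (rule is_pullbackI[OF Comp_in_Hom[OF d z(1)] z(1) Ident_in_Hom[OF O(1)] d])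
    show "(z \<odot> d) \<odot> Ident C D = z \<odot> d"
      using Comp_Ident_right[OF Comp_in_Hom[OF d z(1)]] .
  next
    fix P' p' q'
    assume a: "p' \<in> Hom C P' D" "q' \<in> Hom C P' E" "(z \<odot> d) \<odot> p' = z \<odot> q'"
    have "q' = d \<odot> p'"
      using mono_cancel[OF z(2,1) a(2) Comp_in_Hom[OF a(1) d]] a(3) Comp_assoc[OF a(1) d z(1)]
      by simp
    then show "\<exists>!u. u \<in> Hom C P' D \<and> p' = Ident C D \<odot> u \<and> q' = d \<odot> u"
      using a(1) Comp_Ident_left by metis
  qed
qed

lemma pushout_Ident_left:
  assumes k: "k \<in> Hom C X Y"
  shows "is_pushout C (Ident C Y) k Y X (Ident C X) k"
proof -
  note O = Hom_Obj[OF k]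
  show ?thesis
    by (rule is_pushoutI[OF Ident_in_Hom[OF O(1)] k Ident_in_Hom[OF O(2)] k])
      (use Comp_Ident_left Comp_Ident_right k in metis)+
qed

text \<open>This is the square by which the derived span is matched to \<open>G\<close> and
  \<open>H\<close> themselves, through identities.\<close>

lemma pushout_Ident_right:
  assumes k: "k \<in> Hom C X Y"
  shows "is_pushout C k (Ident C Y) Y X k (Ident C X)"
proof -
  note O = Hom_Obj[OF k]
  show ?thesis
    by (rule is_pushoutI[OF k Ident_in_Hom[OF O(1)] k Ident_in_Hom[OF O(2)]])
      (use Comp_Ident_left Comp_Ident_right k in metis)+
qed

section \<open>Pasting and cancellation of pushouts\<close>

text \<open>A cocone on the whole rectangle factors through the first square and then through the
  second. This later transports the squares over \<open>ws_l\<close> and \<open>ws_r\<close> along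
  the pushouts of \<open>G\<close> and of the \<open>F a\<close>.\<close>

lemma pushout_comp:
  assumes 1: "is_pushout C g1 n1 H1 I r d" and 2: "is_pushout C g2 n2 H2 D g1 d2"
    and r: "r \<in> Hom C I R" and d: "d \<in> Hom C I D" and d2: "d2 \<in> Hom C D D2"
  shows "is_pushout C g2 (n2 \<odot> n1) H2 I r (d2 \<odot> d)"
proof -
  note a1 = pushout_arrows[OF 1 r d]
  note a2 = pushout_arrows[OF 2 a1(1) d2]
  show ?thesis
  proof (rule is_pushoutI[OF r Comp_in_Hom[OF d d2] a2(1) Comp_in_Hom[OF a1(2) a2(2)]])
    show "g2 \<odot> (d2 \<odot> d) = (n2 \<odot> n1) \<odot> r"
      using Comp_assoc[OF d d2 a2(1)] Comp_assoc[OF d a1(1) a2(2)] Comp_assoc[OF r a1(2) a2(2)]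
        a1(3) a2(3) by simp
  next
    fix H' g' n'
    assume g': "g' \<in> Hom C D2 H'" and n': "n' \<in> Hom C R H'"
      and eq: "g' \<odot> (d2 \<odot> d) = n' \<odot> r"
    have "(g' \<odot> d2) \<odot> d = n' \<odot> r"
      using eq Comp_assoc[OF d d2 g'] by simp
    then obtain v where v: "v \<in> Hom C H1 H'" "g' \<odot> d2 = v \<odot> g1" "n' = v \<odot> n1"
      using pushout_ex1[OF 1 r d Comp_in_Hom[OF d2 g'] n'] by blast
    then obtain u where u: "u \<in> Hom C H2 H'" "g' = u \<odot> g2" "v = u \<odot> n2"
      using pushout_ex1[OF 2 a1(1) d2 g' v(1)] by blast
    then show "\<exists>u. u \<in> Hom C H2 H' \<and> g' = u \<odot> g2 \<and> n' = u \<odot> (n2 \<odot> n1)"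
      using v(3) Comp_assoc[OF a1(2) a2(2) u(1)] by auto
  next
    fix H' u v
    assume u: "u \<in> Hom C H2 H'" and v: "v \<in> Hom C H2 H'"
      and eq: "u \<odot> g2 = v \<odot> g2" "u \<odot> (n2 \<odot> n1) = v \<odot> (n2 \<odot> n1)"
    have "u \<odot> n2 = v \<odot> n2"
    proof (rule pushout_ext[OF 1 r d Comp_in_Hom[OF a2(2) u] Comp_in_Hom[OF a2(2) v]])
      show "(u \<odot> n2) \<odot> g1 = (v \<odot> n2) \<odot> g1"
        using Comp_assoc[OF a1(1) a2(2) u] Comp_assoc[OF a1(1) a2(2) v] eq(1) a2(3)
          Comp_assoc[OF d2 a2(1) u] Comp_assoc[OF d2 a2(1) v] by metis
      show "(u \<odot> n2) \<odot> n1 = (v \<odot> n2) \<odot> n1"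
        using eq(2) Comp_assoc[OF a1(2) a2(2) u] Comp_assoc[OF a1(2) a2(2) v] by simp
    qed
    then show "u = v" using pushout_ext[OF 2 a1(1) d2 u v eq(1)] by simp
  qed
qed

text \<open>A cocone on the right square, composed with \<open>g1\<close>, is a cocone on the outer
  one. The arrow so obtained agrees with \<open>g'\<close> because \<open>g1\<close> and
  \<open>n1\<close> are jointly epic. It serves to split a square over a composite
  \<open>f a \<odot> e a\<close> at \<open>D a\<close>.\<close>

lemma pushout_decomp:
  assumes 1: "is_pushout C g1 n1 H1 I r1 d" and 2: "is_pushout C g n H I (r2 \<odot> r1) d"
    and r1: "r1 \<in> Hom C I R1" and r2: "r2 \<in> Hom C R1 R" and d: "d \<in> Hom C I D"
    and w: "w \<in> Hom C H1 H" "w \<odot> g1 = g" "w \<odot> n1 = n \<odot> r2"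
  shows "is_pushout C w n H R1 r2 n1"
proof -
  note a1 = pushout_arrows[OF 1 r1 d]
  note r21 = Comp_in_Hom[OF r1 r2]
  note a2 = pushout_arrows[OF 2 r21 d]
  show ?thesis
  proof (rule is_pushoutI[OF r2 a1(2) w(1) a2(2) w(3)])
    fix H' g' n'
    assume g': "g' \<in> Hom C H1 H'" and n': "n' \<in> Hom C R H'" and eq: "g' \<odot> n1 = n' \<odot> r2"
    have "(g' \<odot> g1) \<odot> d = n' \<odot> (r2 \<odot> r1)"
      using Comp_assoc[OF d a1(1) g'] Comp_assoc[OF r1 a1(2) g'] Comp_assoc[OF r1 r2 n'] eq a1(3)
      by simp
    then obtain u where u: "u \<in> Hom C H H'" "g' \<odot> g1 = u \<odot> g" "n' = u \<odot> n"
      using pushout_ex1[OF 2 r21 d Comp_in_Hom[OF a1(1) g'] n'] by blast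
    have "g' = u \<odot> w"
    proof (rule pushout_ext[OF 1 r1 d g' Comp_in_Hom[OF w(1) u(1)]])
      show "g' \<odot> g1 = (u \<odot> w) \<odot> g1"
        using u(2) w(2) Comp_assoc[OF a1(1) w(1) u(1)] by simp
      show "g' \<odot> n1 = (u \<odot> w) \<odot> n1"
        using eq u(3) w(3) Comp_assoc[OF a1(2) w(1) u(1)] Comp_assoc[OF r2 a2(2) u(1)] by simp
    qed
    then show "\<exists>u. u \<in> Hom C H H' \<and> g' = u \<odot> w \<and> n' = u \<odot> n" using u by blast
  next
    fix H' u v
    assume u: "u \<in> Hom C H H'" and v: "v \<in> Hom C H H'"
      and eq: "u \<odot> w = v \<odot> w" "u \<odot> n = v \<odot> n"
    have "u \<odot> g = v \<odot> g"
      using Comp_assoc[OF a1(1) w(1) u] Comp_assoc[OF a1(1) w(1) v] eq(1) w(2) by simp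
    then show "u = v" using pushout_ext[OF 2 r21 d u v] eq(2) by simp
  qed
qed

section \<open>Limits of families with a common codomain\<close>

text \<open>The pairwise cone equations amount to one common composite \<open>t\<close>, because the
  family is nonempty. Working with \<open>t\<close> keeps later calculations linear in the
  index.\<close>

lemma is_limitI:
  assumes "1 \<le> p" "t \<in> Hom C X G"
    and "\<And>a. a \<in> {1..p} \<Longrightarrow> f a \<in> Hom C (D a) G"
    and "\<And>a. a \<in> {1..p} \<Longrightarrow> e a \<in> Hom C X (D a)"
    and "\<And>a. a \<in> {1..p} \<Longrightarrow> f a \<odot> e a = t"
    and "\<And>Y e' t'. \<lbrakk>t' \<in> Hom C Y G; \<And>a. a \<in> {1..p} \<Longrightarrow> e' a \<in> Hom C Y (D a);
            \<And>a. a \<in> {1..p} \<Longrightarrow> f a \<odot> e' a = t'\<rbrakk>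
          \<Longrightarrow> \<exists>u. u \<in> Hom C Y X \<and> (\<forall>a \<in> {1..p}. e' a = e a \<odot> u)"
    and "\<And>Y u v. \<lbrakk>u \<in> Hom C Y X; v \<in> Hom C Y X; \<And>a. a \<in> {1..p} \<Longrightarrow> e a \<odot> u = e a \<odot> v\<rbrakk>
          \<Longrightarrow> u = v"
  shows "is_limit C p D f G X e"
  unfolding is_limit_def
proof (intro conjI ballI allI impI)
  fix Y e'
  assume Y: "Y \<in> Obj C"
    and e': "(\<forall>a \<in> {1..p}. e' a \<in> Hom C Y (D a)) \<and>
        (\<forall>a \<in> {1..p}. \<forall>b \<in> {1..p}. f a \<odot> e' a = f b \<odot> e' b)"
  have one: "1 \<in> {1..p}" using assms(1) by simp
  have "\<exists>u. u \<in> Hom C Y X \<and> (\<forall>a \<in> {1..p}. e' a = e a \<odot> u)"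
  proof (rule assms(6))
    show "f 1 \<odot> e' 1 \<in> Hom C Y G" using e' one assms(3) Comp_in_Hom by blast
    show "f a \<odot> e' a = f 1 \<odot> e' 1" if "a \<in> {1..p}" for a using e' one that by blast
  qed (use e' in blast)
  then show "\<exists>!u. u \<in> Hom C Y X \<and> (\<forall>a \<in> {1..p}. e' a = e a \<odot> u)"
    using assms(7)[of _ Y] by metis
qed (use assms(3-5) Hom_Obj[OF assms(2)] in auto)

lemma limit_arrows:
  assumes lim: "is_limit C p D f G X e" and a: "a \<in> {1..p}"
  shows "f a \<in> Hom C (D a) G" "e a \<in> Hom C X (D a)"
    "b \<in> {1..p} \<Longrightarrow> f a \<odot> e a = f b \<odot> e b"
proof -
  note l = lim[unfolded is_limit_def, THEN conjunct2, THEN conjunct2]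
  show "f a \<in> Hom C (D a) G" by (rule bspec[OF conjunct1[OF l] a])
  show "e a \<in> Hom C X (D a)" by (rule bspec[OF conjunct1[OF conjunct2[OF l]] a])
  show "f a \<odot> e a = f b \<odot> e b" if b: "b \<in> {1..p}"
    by (rule bspec[OF bspec[OF conjunct1[OF conjunct2[OF conjunct2[OF l]]] a] b])
qed

lemma limit_ex1:
  assumes lim: "is_limit C p D f G X e" and Y: "Y \<in> Obj C"
    and e': "\<And>a. a \<in> {1..p} \<Longrightarrow> e' a \<in> Hom C Y (D a)"
    and t: "\<And>a. a \<in> {1..p} \<Longrightarrow> f a \<odot> e' a = t"
  shows "\<exists>!u. u \<in> Hom C Y X \<and> (\<forall>a \<in> {1..p}. e' a = e a \<odot> u)"
proof -
  note univ = lim[unfolded is_limit_def, THEN conjunct2, THEN conjunct2, THEN conjunct2,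
      THEN conjunct2, THEN conjunct2]
  have "\<forall>a \<in> {1..p}. e' a \<in> Hom C Y (D a)" using e' by (intro ballI)
  moreover have "\<forall>a \<in> {1..p}. \<forall>b \<in> {1..p}. f a \<odot> e' a = f b \<odot> e' b"
    using t by (intro ballI) metis
  ultimately show ?thesis by (rule mp[OF spec[OF bspec[OF univ Y], of e'], OF conjI])
qed

text \<open>The arrows \<open>e a \<odot> u\<close> form a cone with common composite
  \<open>(f 1 \<odot> e 1) \<odot> u\<close>, and both \<open>u\<close> and \<open>v\<close> mediate
  it: the projections are jointly monic.\<close>

lemma limit_ext:
  assumes lim: "is_limit C p D f G X e" and p: "1 \<le> p"
    and u: "u \<in> Hom C Y X" and v: "v \<in> Hom C Y X"
    and eq: "\<And>a. a \<in> {1..p} \<Longrightarrow> e a \<odot> u = e a \<odot> v"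
  shows "u = v"
proof -
  have "f a \<odot> (e a \<odot> u) = (f 1 \<odot> e 1) \<odot> u" if a: "a \<in> {1..p}" for a
  proof -
    have "(f a \<odot> e a) \<odot> u = f a \<odot> (e a \<odot> u)"
      by (rule Comp_assoc[OF u limit_arrows(2)[OF lim a] limit_arrows(1)[OF lim a]])
    moreover have "f a \<odot> e a = f 1 \<odot> e 1"
      using limit_arrows(3)[OF lim a, of 1] p by simp
    ultimately show ?thesis by simp
  qed
  from limit_ex1[OF lim Hom_Obj(1)[OF u], of "\<lambda>a. e a \<odot> u", OF _ this]
  have "\<exists>!w. w \<in> Hom C Y X \<and> (\<forall>a \<in> {1..p}. e a \<odot> u = e a \<odot> w)"
    using Comp_in_Hom[OF u] limit_arrows(2)[OF lim] by blast
  then show ?thesis using u v eq by blast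
qed

text \<open>Each limit mediates the cone of the other, and joint monicity makes the two mediating
  arrows mutually inverse. This carries facts about a constructed limit over to a given one.\<close>

lemma limit_iso:
  assumes lim: "is_limit C p D f G X e" and lim': "is_limit C p D f G X' e'" and p: "1 \<le> p"
  obtains u where "u \<in> Hom C X X'" "is_iso C u" "\<And>a. a \<in> {1..p} \<Longrightarrow> e a = e' a \<odot> u"
proof -
  have one: "1 \<in> {1..p}" using p by simp
  have ex: "\<exists>u. u \<in> Hom C Y Y' \<and> (\<forall>a \<in> {1..p}. c a = c' a \<odot> u)"
    if l: "is_limit C p D f G Y c" and l': "is_limit C p D f G Y' c'" for Y Y' c c'
  proof -
    have "Y \<in> Obj C" using l unfolding is_limit_def by blast
    then show ?thesis
      using limit_ex1[OF l', of Y c "f 1 \<odot> c 1"] limit_arrows(2)[OF l] limit_arrows(3)[OF l _ one]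
      by blast
  qed
  obtain u where u: "u \<in> Hom C X X'" "\<forall>a \<in> {1..p}. e a = e' a \<odot> u" using ex[OF lim lim'] by blast
  obtain v where v: "v \<in> Hom C X' X" "\<forall>a \<in> {1..p}. e' a = e a \<odot> v" using ex[OF lim' lim] by blast
  have "v \<odot> u = Ident C X"
  proof (rule limit_ext[OF lim p Comp_in_Hom[OF u(1) v(1)] Ident_in_Hom[OF Hom_Obj(1)[OF u(1)]]])
    fix a assume a: "a \<in> {1..p}"
    show "e a \<odot> (v \<odot> u) = e a \<odot> Ident C X"
      using Comp_assoc[OF u(1) v(1) limit_arrows(2)[OF lim a]] u(2) v(2) a
        Comp_Ident_right[OF limit_arrows(2)[OF lim a]] by simp
  qed
  moreover have "u \<odot> v = Ident C X'"
  proof (rule limit_ext[OF lim' p Comp_in_Hom[OF v(1) u(1)] Ident_in_Hom[OF Hom_Obj(1)[OF v(1)]]])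
    fix a assume a: "a \<in> {1..p}"
    show "e' a \<odot> (u \<odot> v) = e' a \<odot> Ident C X'"
      using Comp_assoc[OF v(1) u(1) limit_arrows(2)[OF lim' a]] u(2) v(2) a
        Comp_Ident_right[OF limit_arrows(2)[OF lim' a]] by simp
  qed
  ultimately have "is_iso C u"
    using u(1) v(1) Hom_DomCod[OF u(1)] unfolding is_iso_def by auto
  then show ?thesis using that u by blast
qed

section \<open>Colimits and their stability under pushout\<close>

lemma colimit_arrows:
  assumes col: "is_colimit C p X s F h H" and a: "a \<in> {1..p}"
  shows "s a \<in> Hom C X (F a)" "h a \<in> Hom C (F a) H"
    "b \<in> {1..p} \<Longrightarrow> h a \<odot> s a = h b \<odot> s b"
proof -
  note c = col[unfolded is_colimit_def, THEN conjunct2, THEN conjunct2]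
  show "s a \<in> Hom C X (F a)" by (rule bspec[OF conjunct1[OF c] a])
  show "h a \<in> Hom C (F a) H" by (rule bspec[OF conjunct1[OF conjunct2[OF c]] a])
  show "h a \<odot> s a = h b \<odot> s b" if b: "b \<in> {1..p}"
    by (rule bspec[OF bspec[OF conjunct1[OF conjunct2[OF conjunct2[OF c]]] a] b])
qed

lemma colimit_ex1:
  assumes col: "is_colimit C p X s F h H" and Z: "Z \<in> Obj C"
    and h': "\<And>a. a \<in> {1..p} \<Longrightarrow> h' a \<in> Hom C (F a) Z"
    and y: "\<And>a. a \<in> {1..p} \<Longrightarrow> h' a \<odot> s a = y"
  shows "\<exists>!u. u \<in> Hom C H Z \<and> (\<forall>a \<in> {1..p}. h' a = u \<odot> h a)"
proof -
  note univ = col[unfolded is_colimit_def, THEN conjunct2, THEN conjunct2, THEN conjunct2,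
      THEN conjunct2, THEN conjunct2]
  have "\<forall>a \<in> {1..p}. h' a \<in> Hom C (F a) Z" using h' by (intro ballI)
  moreover have "\<forall>a \<in> {1..p}. \<forall>b \<in> {1..p}. h' a \<odot> s a = h' b \<odot> s b"
    using y by (intro ballI) metis
  ultimately show ?thesis by (rule mp[OF spec[OF bspec[OF univ Z], of h'], OF conjI])
qed

text \<open>The colimit is a coproduct in the category of arrows out of \<open>X\<close>. Pushout
  along \<open>k\<close> behaves as a left adjoint to precomposition with \<open>k\<close>, and so
  preserves it. The proof spells this argument out for the given squares.\<close>

lemma colimit_pushout:
  assumes col: "is_colimit C p X s F h H" and p: "1 \<le> p"
    and y: "y \<in> Hom C X H" "\<And>a. a \<in> {1..p} \<Longrightarrow> h a \<odot> s a = y"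
    and k: "k \<in> Hom C X D"
    and po: "is_pushout C g n H' X y k"
    and poF: "\<And>a. a \<in> {1..p} \<Longrightarrow> is_pushout C (s' a) (\<phi> a) (F' a) X (s a) k"
  shows "\<exists>h'. is_colimit C p D s' F' h' H'"
proof -
  note s = colimit_arrows(1)[OF col] and h = colimit_arrows(2)[OF col]
  note aH = pushout_arrows[OF po y(1) k]
  have aF: "s' a \<in> Hom C D (F' a)" "\<phi> a \<in> Hom C (F a) (F' a)" "s' a \<odot> k = \<phi> a \<odot> s a"
    if a: "a \<in> {1..p}" for a
    using pushout_arrows[OF poF[OF a] s[OF a] k] by auto
  \<comment> \<open>The new colimit legs are the arrows induced on each \<open>F' a\<close> by
    \<open>g\<close> and \<open>n \<odot> h a\<close>.\<close>
  have "\<exists>w. w \<in> Hom C (F' a) H' \<and> g = w \<odot> s' a \<and> n \<odot> h a = w \<odot> \<phi> a" if a: "a \<in> {1..p}" for a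
  proof -
    have "g \<odot> k = (n \<odot> h a) \<odot> s a"
      using aH(3) y(2)[OF a] Comp_assoc[OF s[OF a] h[OF a] aH(2)] by simp
    then show ?thesis
      using pushout_ex1[OF poF[OF a] s[OF a] k aH(1) Comp_in_Hom[OF h[OF a] aH(2)]] by blast
  qed
  then obtain h' where h': "\<And>a. a \<in> {1..p} \<Longrightarrow> h' a \<in> Hom C (F' a) H'"
    and h's: "\<And>a. a \<in> {1..p} \<Longrightarrow> h' a \<odot> s' a = g"
    and h'\<phi>: "\<And>a. a \<in> {1..p} \<Longrightarrow> h' a \<odot> \<phi> a = n \<odot> h a" by metis
  have "is_colimit C p D s' F' h' H'"
    unfolding is_colimit_def
  proof (intro conjI ballI allI impI)
    show "D \<in> Obj C" "H' \<in> Obj C" using Hom_Obj[OF aH(1)] by auto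
  next
    fix Z c
    assume Z: "Z \<in> Obj C"
      and asm: "(\<forall>a \<in> {1..p}. c a \<in> Hom C (F' a) Z) \<and>
        (\<forall>a \<in> {1..p}. \<forall>b \<in> {1..p}. c a \<odot> s' a = c b \<odot> s' b)"
    have one: "1 \<in> {1..p}" using p by simp
    define t where "t = c 1 \<odot> s' 1"
    have c: "c a \<in> Hom C (F' a) Z" "c a \<odot> s' a = t" if "a \<in> {1..p}" for a
      using asm that one unfolding t_def by blast+
    have t: "t \<in> Hom C D Z" unfolding t_def using Comp_in_Hom[OF aF(1) c(1)] one by blast
    \<comment> \<open>Restricted along the \<open>\<phi> a\<close>, the given cocone becomes one
      under the original \<open>s a\<close>, with common composite
      \<open>t \<odot> k\<close>.\<close>
    have cs: "(c a \<odot> \<phi> a) \<odot> s a = t \<odot> k" if a: "a \<in> {1..p}" for a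
      using Comp_assoc[OF s[OF a] aF(2)[OF a] c(1)[OF a]] aF(3)[OF a]
        Comp_assoc[OF k aF(1)[OF a] c(1)[OF a]] c(2)[OF a] by simp
    have "c a \<odot> \<phi> a \<in> Hom C (F a) Z" if a: "a \<in> {1..p}" for a
      by (rule Comp_in_Hom[OF aF(2)[OF a] c(1)[OF a]])
    from colimit_ex1[OF col Z this cs]
    have colu: "\<exists>!v. v \<in> Hom C H Z \<and> (\<forall>a \<in> {1..p}. c a \<odot> \<phi> a = v \<odot> h a)" .
    then obtain v where v: "v \<in> Hom C H Z" "\<forall>a \<in> {1..p}. c a \<odot> \<phi> a = v \<odot> h a" by blast
    \<comment> \<open>Agreement on \<open>X\<close> lets \<open>v\<close> and \<open>t\<close> be
      glued over the pushout \<open>H'\<close>.\<close>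
    have "v \<odot> y = t \<odot> k"
      using cs[OF one] v(2) one Comp_assoc[OF s[OF one] h[OF one] v(1)] y(2)[OF one] by simp
    then obtain u where u: "u \<in> Hom C H' Z" "t = u \<odot> g" "v = u \<odot> n"
      using pushout_ex1[OF po y(1) k t v(1)] by metis
    have "c a = u \<odot> h' a" if a: "a \<in> {1..p}" for a
    proof (rule pushout_ext[OF poF[OF a] s[OF a] k c(1)[OF a] Comp_in_Hom[OF h'[OF a] u(1)]])
      show "c a \<odot> s' a = (u \<odot> h' a) \<odot> s' a"
        using c(2)[OF a] u(2) h's[OF a] Comp_assoc[OF aF(1)[OF a] h'[OF a] u(1)] by simp
      show "c a \<odot> \<phi> a = (u \<odot> h' a) \<odot> \<phi> a"
        using v(2) a u(3) h'\<phi>[OF a] Comp_assoc[OF aF(2)[OF a] h'[OF a] u(1)]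
          Comp_assoc[OF h[OF a] aH(2) u(1)] by simp
    qed
    moreover have "u' = u" if u': "u' \<in> Hom C H' Z" "\<forall>a \<in> {1..p}. c a = u' \<odot> h' a" for u'
    proof (rule pushout_ext[OF po y(1) k u'(1) u(1)])
      show "u' \<odot> g = u \<odot> g"
        using u(2) c(2)[OF one] h's[OF one] u'(2) one
          Comp_assoc[OF aF(1)[OF one] h'[OF one] u'(1)] by simp
      \<comment> \<open>The arrow \<open>u' \<odot> n\<close> mediates the restricted cocone, just
        as \<open>v\<close> does.\<close>
      have "c a \<odot> \<phi> a = (u' \<odot> n) \<odot> h a" if a: "a \<in> {1..p}" for a
        using u'(2) a h'\<phi>[OF a] Comp_assoc[OF aF(2)[OF a] h'[OF a] u'(1)]
          Comp_assoc[OF h[OF a] aH(2) u'(1)] by simp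
      then have "u' \<odot> n = v" using colu v Comp_in_Hom[OF aH(2) u'(1)] by blast
      then show "u' \<odot> n = u \<odot> n" using u(3) by simp
    qed
    ultimately show "\<exists>!u. u \<in> Hom C H' Z \<and> (\<forall>a \<in> {1..p}. c a = u \<odot> h' a)"
      using u(1) by blast
  next
    fix a b assume a: "a \<in> {1..p}" and b: "b \<in> {1..p}"
    show "h' a \<odot> s' a = h' b \<odot> s' b" using h's[OF a] h's[OF b] by simp
  qed (use h' aF(1) in blast)+
  then show ?thesis by blast
qed

end

section \<open>Consequences of the Van Kampen property\<close>

context adhesive_hlr
begin

text \<open>The Van Kampen property of the given square for the cube whose vertical arrows are
  \<open>Ident I\<close>, \<open>Ident D\<close>, \<open>r\<close> and \<open>z\<close>; its top face is a pushout iff \<open>v\<close> is an isomorphism.\<close>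

lemma van_kampen_mono:
  assumes po: "is_pushout C (z \<odot> v) n H I r d" and rM: "r \<in> M"
    and r: "r \<in> Hom C I R" and d: "d \<in> Hom C I D"
    and z: "z \<in> Hom C E H" "is_mono C z" and v: "v \<in> Hom C D E"
  shows "is_pushout C v (v \<odot> d) E I (Ident C I) d \<longleftrightarrow> is_pullback C I r (v \<odot> d) n z H"
proof -
  note a = pushout_arrows[OF po r d]
  note O = Hom_Obj[OF d]
  have idI: "Ident C I \<in> Hom C I I" and idD: "Ident C D \<in> Hom C D D" using O Ident_in_Hom by auto
  have b1: "is_pullback C I (Ident C I) d d (Ident C D) D" by (rule pullback_Ident[OF d])
  have b2: "is_pullback C I (Ident C I) (Ident C I) r r R"
    using pullback_mono[OF r M_mono[OF rM] idI] Comp_Ident_right[OF r] by simp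
  \<comment> \<open>Both back faces and this front face are pullbacks whatever the square is, so the
    equivalence reduces to the front face over \<open>R\<close>.\<close>
  have f1: "is_pullback C D (Ident C D) v (z \<odot> v) z H" by (rule pullback_mono[OF z v])
  have e1: "v \<odot> d = (v \<odot> d) \<odot> Ident C I" using Comp_Ident_right[OF Comp_in_Hom[OF d v]] by simp
  have e2: "z \<odot> v = (z \<odot> v) \<odot> Ident C D" using Comp_Ident_right[OF a(1)] by simp
  have e3: "z \<odot> (v \<odot> d) = n \<odot> r" using a(3) Comp_assoc[OF d v z(1)] by simp
  have vk: "\<forall>W' X' Y' Z' b' c' f' g' w x y za.
        b' \<in> Hom C W' X' \<and> c' \<in> Hom C W' Y' \<and> f' \<in> Hom C X' Z' \<and> g' \<in> Hom C Y' Z' \<and>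
        w \<in> Hom C W' I \<and> x \<in> Hom C X' D \<and> y \<in> Hom C Y' R \<and> za \<in> Hom C Z' H \<and>
        f' \<odot> b' = g' \<odot> c' \<and> za \<odot> f' = (z \<odot> v) \<odot> x \<and> za \<odot> g' = n \<odot> y \<and>
        is_pullback C W' w b' d x D \<and> is_pullback C W' w c' r y R \<longrightarrow>
        (is_pushout C f' g' Z' W' c' b' \<longleftrightarrow>
         is_pullback C X' x f' (z \<odot> v) za H \<and> is_pullback C Y' y g' n za H)"
    using M_van_kampen[OF po rM]
    unfolding is_van_kampen_def Hom_DomCod[OF d] Hom_DomCod[OF r] by (rule conjunct2)
  show ?thesis
    using vk[rule_format, of d I D "Ident C I" I v E "v \<odot> d" "Ident C I" "Ident C D" r z]
      d idI v Comp_in_Hom[OF d v] idD r z(1) e1 e2 e3 b1 b2 f1 by blast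
qed

text \<open>In the cube with \<open>z = g\<close> and \<open>v\<close> the identity of
  \<open>D\<close>, the top face is the trivial pushout along an identity, and the remaining front
  face is the square itself.\<close>

lemma pushout_is_pullback:
  assumes po: "is_pushout C g n H I r d" and rM: "r \<in> M"
    and r: "r \<in> Hom C I R" and d: "d \<in> Hom C I D"
  shows "is_pullback C I r d n g H"
proof -
  note a = pushout_arrows[OF po r d]
  have gM: "is_mono C g" by (rule M_mono[OF M_pushout[OF po rM]])
  have idD: "Ident C D \<in> Hom C D D" using Ident_in_Hom Hom_Obj[OF d] by auto
  show ?thesis
    using van_kampen_mono[of g "Ident C D", OF _ rM r d a(1) gM idD] po pushout_Ident_left[OF d]
      Comp_Ident_right[OF a(1)] Comp_Ident_left[OF d] by simp
qed

section \<open>Finite intersections of \<open>M\<close>-subobjects\<close>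

text \<open>Subobjects are intersected one at a time, by pulling the next one back along the
  diagonal of the limit already built. That the diagonal lies in \<open>M\<close> is carried through
  the induction.\<close>

lemma finite_intersection:
  assumes "1 \<le> p" "\<And>a. a \<in> {1..p} \<Longrightarrow> f a \<in> Hom C (D a) G" "\<And>a. a \<in> {1..p} \<Longrightarrow> f a \<in> M"
  shows "\<exists>X e. is_limit C p D f G X e \<and> f 1 \<odot> e 1 \<in> M"
  using assms
proof (induction p rule: nat_induct_at_least)
  case base
  have f: "f 1 \<in> Hom C (D 1) G" "f 1 \<in> M" using base by auto
  have i: "Ident C (D 1) \<in> Hom C (D 1) (D 1)" using Ident_in_Hom Hom_Obj[OF f(1)] by auto
  \<comment> \<open>A single arrow has its domain as limit; only the entry of the identity family at
    index 1 matters.\<close>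
  have "is_limit C 1 D f G (D 1) (\<lambda>a. Ident C (D a))"
  proof (rule is_limitI[where t = "f 1"])
    fix Y e' t'
    assume e': "\<And>a. a \<in> {1..1} \<Longrightarrow> e' a \<in> Hom C Y (D a)"
    have "e' 1 \<in> Hom C Y (D 1)" using e' by simp
    then show "\<exists>u. u \<in> Hom C Y (D 1) \<and> (\<forall>a \<in> {1..1}. e' a = Ident C (D a) \<odot> u)"
      using Comp_Ident_left by auto
  next
    fix Y u v
    assume u: "u \<in> Hom C Y (D 1)" and v: "v \<in> Hom C Y (D 1)"
      and "\<And>a. a \<in> {1..1} \<Longrightarrow> Ident C (D a) \<odot> u = Ident C (D a) \<odot> v"
    then have "Ident C (D 1) \<odot> u = Ident C (D 1) \<odot> v" by simp
    then show "u = v" using Comp_Ident_left[OF u] Comp_Ident_left[OF v] by simp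
  qed (use f i Comp_Ident_right in auto)
  then show ?case using f Comp_Ident_right[OF f(1)] by metis
next
  case (Suc p)
  then obtain X e where lim: "is_limit C p D f G X e" and tM: "f 1 \<odot> e 1 \<in> M"
    by (auto simp del: One_nat_def)
  define t where "t = f 1 \<odot> e 1"
  have one: "1 \<in> {1..p}" using Suc.hyps by simp
  note l = limit_arrows[OF lim]
  have t: "t \<in> Hom C X G" unfolding t_def using Comp_in_Hom l one by blast
  have fS: "f (Suc p) \<in> Hom C (D (Suc p)) G" "f (Suc p) \<in> M" using Suc.prems by auto
  obtain P q0 q where pb: "is_pullback C P q0 q (f (Suc p)) t G"
    using pullback_exists[OF fS(1) t fS(2)] by blast
  note a = pullback_arrows[OF pb fS(1) t]
  \<comment> \<open>The new projection is a leg of the pullback; the old ones are precomposed with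
    the other leg.\<close>
  define e' where "e' a = (if a = Suc p then q0 else e a \<odot> q)" for a
  have sp: "a = Suc p \<or> a \<in> {1..p}" if "a \<in> {1..Suc p}" for a using that by auto
  have e'p: "e' a = e a \<odot> q" if "a \<in> {1..p}" for a using that unfolding e'_def by auto
  have fe': "f a \<odot> e' a = t \<odot> q" if "a \<in> {1..Suc p}" for a
    using sp[OF that]
  proof
    assume "a = Suc p" then show ?thesis using a(3) unfolding e'_def by simp
  next
    assume ap: "a \<in> {1..p}"
    show ?thesis using Comp_assoc[OF a(2) l(2)[OF ap] l(1)[OF ap]] l(3)[OF ap one] e'p[OF ap]
      unfolding t_def by simp
  qed
  have "is_limit C (Suc p) D f G P e'"
  proof (rule is_limitI[OF _ Comp_in_Hom[OF a(2) t]])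
    fix Y c t'
    assume t': "t' \<in> Hom C Y G" and c: "\<And>a. a \<in> {1..Suc p} \<Longrightarrow> c a \<in> Hom C Y (D a)"
      and fc: "\<And>a. a \<in> {1..Suc p} \<Longrightarrow> f a \<odot> c a = t'"
    have sub: "a \<in> {1..Suc p}" if "a \<in> {1..p}" for a using that by simp
    obtain w where w: "w \<in> Hom C Y X" "\<forall>a \<in> {1..p}. c a = e a \<odot> w"
      using limit_ex1[OF lim Hom_Obj(1)[OF t'] c[OF sub] fc[OF sub]] by blast
    have cS: "c (Suc p) \<in> Hom C Y (D (Suc p))" using c by simp
    have c1: "c 1 = e 1 \<odot> w" using w(2) one by blast
    have f1: "f 1 \<odot> c 1 = t'" using one by (intro fc) auto
    have "f (Suc p) \<odot> c (Suc p) = t \<odot> w"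
      using fc[of "Suc p"] f1 c1 Comp_assoc[OF w(1) l(2)[OF one] l(1)[OF one]]
      unfolding t_def by simp
    then obtain u where u: "u \<in> Hom C Y P" "c (Suc p) = q0 \<odot> u" "w = q \<odot> u"
      using pullback_ex1[OF pb fS(1) t cS w(1)] by blast
    have "c a = e' a \<odot> u" if "a \<in> {1..Suc p}" for a
      using sp[OF that]
    proof
      assume "a = Suc p" then show ?thesis using u unfolding e'_def by simp
    next
      assume ap: "a \<in> {1..p}"
      then show ?thesis using w(2) u(3) e'p[OF ap] Comp_assoc[OF u(1) a(2) l(2)[OF ap]] by simp
    qed
    then show "\<exists>u. u \<in> Hom C Y P \<and> (\<forall>a \<in> {1..Suc p}. c a = e' a \<odot> u)" using u(1) by blast
  next
    fix Y u v
    assume u: "u \<in> Hom C Y P" and v: "v \<in> Hom C Y P"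
      and eq: "\<And>a. a \<in> {1..Suc p} \<Longrightarrow> e' a \<odot> u = e' a \<odot> v"
    have 1: "q0 \<odot> u = q0 \<odot> v" using eq[of "Suc p"] unfolding e'_def by simp
    have 2: "q \<odot> u = q \<odot> v"
    proof (rule limit_ext[OF lim Suc.hyps Comp_in_Hom[OF u a(2)] Comp_in_Hom[OF v a(2)]])
      fix b assume b: "b \<in> {1..p}"
      then show "e b \<odot> (q \<odot> u) = e b \<odot> (q \<odot> v)"
        using eq[of b] e'p[OF b] Comp_assoc[OF u a(2) l(2)[OF b]] Comp_assoc[OF v a(2) l(2)[OF b]]
        by simp
    qed
    have "f (Suc p) \<odot> (q0 \<odot> u) = t \<odot> (q \<odot> u)"
      using a(3) Comp_assoc[OF u a(1) fS(1)] Comp_assoc[OF u a(2) t] by simp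
    then show "u = v"
      using pullback_ex1[OF pb fS(1) t Comp_in_Hom[OF u a(1)] Comp_in_Hom[OF u a(2)]] u v 1 2
      by blast
  next
    fix b assume b: "b \<in> {1..Suc p}"
    show "f b \<in> Hom C (D b) G" by (rule Suc.prems(1)[OF b])
    show "f b \<odot> e' b = t \<odot> q" by (rule fe'[OF b])
    show "e' b \<in> Hom C P (D b)"
      using sp[OF b] a(1) e'p Comp_in_Hom[OF a(2) l(2)] unfolding e'_def by auto
  qed simp
  \<comment> \<open>The new diagonal is \<open>t \<odot> q\<close>, where \<open>q\<close> lies in
    \<open>M\<close> as the arrow opposite to \<open>f (Suc p)\<close>.\<close>
  moreover have "f 1 \<odot> e' 1 \<in> M"
    using fe'[of 1] M_comp[OF a(2) t M_pullback[OF pb fS(2)]] tM unfolding t_def by simp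
  ultimately show ?case by blast
qed

text \<open>The limit built by \<open>finite_intersection\<close> has its diagonal in
  \<open>M\<close>. Any other limit differs from it by an isomorphism, which lies in
  \<open>M\<close> too.\<close>

lemma limit_in_M:
  assumes lim: "is_limit C p D f G X e" and p: "1 \<le> p"
    and fM: "\<And>a. a \<in> {1..p} \<Longrightarrow> f a \<in> M" and a: "a \<in> {1..p}"
  shows "f a \<odot> e a \<in> M"
proof -
  have one: "1 \<in> {1..p}" using p by simp
  obtain X' e' where lim': "is_limit C p D f G X' e'" and M': "f 1 \<odot> e' 1 \<in> M"
    using finite_intersection[of p f D G, OF p limit_arrows(1)[OF lim] fM] by blast
  obtain u where u: "u \<in> Hom C X X'" "is_iso C u" "e 1 = e' 1 \<odot> u"
    using limit_iso[OF lim lim' p] one by metis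
  note l = limit_arrows[OF lim' one]
  have "(f 1 \<odot> e' 1) \<odot> u \<in> M"
    using M_comp[OF u(1) Comp_in_Hom[OF l(2,1)] M_iso[OF u(2)] M'] .
  then show ?thesis
    using Comp_assoc[OF u(1) l(2,1)] u(3) limit_arrows(3)[OF lim a one] by simp
qed

text \<open>The limit \<open>E\<close> of the \<open>B a\<close> is compared with \<open>D'\<close> by pulling the pushout square at \<open>G'\<close> back
  along \<open>E \<rightarrow> G'\<close>: since each \<open>D a\<close> is the preimage of \<open>B a\<close>, the preimage of \<open>E\<close> in \<open>G\<close> is \<open>X\<close>.\<close>

lemma limit_pushout:
  assumes lim: "is_limit C p D f G X e" and p: "1 \<le> p"
    and fM: "\<And>a. a \<in> {1..p} \<Longrightarrow> f a \<in> M"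
    and t: "t \<in> Hom C X G" "\<And>a. a \<in> {1..p} \<Longrightarrow> f a \<odot> e a = t"
    and k: "k \<in> Hom C X D'"
    and po: "is_pushout C \<phi> m G' X t k"
    and \<delta>: "\<And>a. a \<in> {1..p} \<Longrightarrow> \<delta> a \<in> Hom C (D a) (B a)"
    and poD: "\<And>a. a \<in> {1..p} \<Longrightarrow> is_pushout C (f' a) m G' (D a) (f a) (\<delta> a)"
    and e': "\<And>a. a \<in> {1..p} \<Longrightarrow> e' a \<in> Hom C D' (B a)"
    and fe': "\<And>a. a \<in> {1..p} \<Longrightarrow> f' a \<odot> e' a = \<phi>"
  shows "is_limit C p B f' G' D' e'"
proof -
  have one: "1 \<in> {1..p}" using p by simp
  note l = limit_arrows[OF lim]
  note a0 = pushout_arrows[OF po t(1) k]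
  have aD: "f' a \<in> Hom C (B a) G'" "m \<in> Hom C G G'" if a: "a \<in> {1..p}" for a
    using pushout_arrows[OF poD[OF a] l(1)[OF a] \<delta>[OF a]] by auto
  have tM: "t \<in> M" using limit_in_M[OF lim p fM one] t(2)[OF one] by simp
  have f'M: "f' a \<in> M" if "a \<in> {1..p}" for a using M_pushout[OF poD[OF that] fM[OF that]] .
  obtain E c where limE: "is_limit C p B f' G' E c"
    using finite_intersection[of p f' B G', OF p aD(1) f'M] by blast
  note lE = limit_arrows[OF limE]
  define z where "z = f' 1 \<odot> c 1"
  have z: "z \<in> Hom C E G'" unfolding z_def using Comp_in_Hom[OF lE(2,1)] one by blast
  have zM: "is_mono C z"
    unfolding z_def by (rule M_mono[OF limit_in_M[OF limE p f'M one]])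
  have fcz: "f' a \<odot> c a = z" if "a \<in> {1..p}" for a
    unfolding z_def using lE(3)[OF that one] .
  \<comment> \<open>The cone on \<open>D'\<close> induces the comparison arrow \<open>v\<close>,
    which will turn out to be an isomorphism.\<close>
  obtain v where v: "v \<in> Hom C D' E" "\<forall>a \<in> {1..p}. e' a = c a \<odot> v"
    using limit_ex1[OF limE Hom_Obj(1)[OF a0(1)], of e' \<phi>] e' fe' by blast
  have zv: "z \<odot> v = \<phi>"
    using Comp_assoc[OF v(1) lE(2)[OF one] lE(1)[OF one]] v(2) one fe'[OF one]
    unfolding z_def by simp
  have zvk: "z \<odot> (v \<odot> k) = m \<odot> t" using zv a0(3) Comp_assoc[OF k v(1) z] by simp
  have "is_pullback C X t (v \<odot> k) m z G'"
  proof (rule is_pullbackI[OF a0(2) z t(1) Comp_in_Hom[OF k v(1)]])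
    show "m \<odot> t = z \<odot> (v \<odot> k)" using zvk by simp
  next
    fix P x y
    assume x: "x \<in> Hom C P G" and y: "y \<in> Hom C P E" and eq: "m \<odot> x = z \<odot> y"
    \<comment> \<open>Each square at \<open>D a\<close> is also a pullback, so an arrow into
      \<open>G\<close> whose image in \<open>G'\<close> factors through \<open>B a\<close> already
      factors through \<open>D a\<close>.\<close>
    have "\<exists>w. w \<in> Hom C P (D a) \<and> x = f a \<odot> w" if a: "a \<in> {1..p}" for a
    proof -
      have "m \<odot> x = f' a \<odot> (c a \<odot> y)"
        using eq fcz[OF a] Comp_assoc[OF y lE(2)[OF a] lE(1)[OF a]] by simp
      then show ?thesis
        using pullback_ex1[OF pushout_is_pullback[OF poD[OF a] fM[OF a] l(1)[OF a] \<delta>[OF a]]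
            aD(2)[OF a] aD(1)[OF a] x Comp_in_Hom[OF y lE(2)[OF a]]] by blast
    qed
    then obtain w where w: "\<And>a. a \<in> {1..p} \<Longrightarrow> w a \<in> Hom C P (D a)"
      "\<And>a. a \<in> {1..p} \<Longrightarrow> f a \<odot> w a = x" by metis
    obtain u where u: "u \<in> Hom C P X" "\<forall>a \<in> {1..p}. w a = e a \<odot> u"
      using limit_ex1[OF lim Hom_Obj(1)[OF x] w] by blast
    have tu: "x = t \<odot> u"
      using w(2)[OF one] u(2) one t(2)[OF one] Comp_assoc[OF u(1) l(2)[OF one] l(1)[OF one]]
      by simp
    have "y = (v \<odot> k) \<odot> u"
    proof (rule mono_cancel[OF zM z y Comp_in_Hom[OF u(1) Comp_in_Hom[OF k v(1)]]])
      show "z \<odot> y = z \<odot> ((v \<odot> k) \<odot> u)"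
        using eq tu zvk Comp_assoc[OF u(1) Comp_in_Hom[OF k v(1)] z]
          Comp_assoc[OF u(1) t(1) a0(2)] by simp
    qed
    moreover have "u' = u" if "u' \<in> Hom C P X" "x = t \<odot> u'" for u'
      using mono_cancel[OF M_mono[OF tM] t(1) that(1) u(1)] that(2) tu by simp
    ultimately show "\<exists>!u. u \<in> Hom C P X \<and> x = t \<odot> u \<and> y = (v \<odot> k) \<odot> u"
      using u(1) tu by blast
  qed
  \<comment> \<open>By the Van Kampen property \<open>v\<close> is opposite to an identity in a
    pushout, and hence invertible; the inverse \<open>u\<close> is induced by
    \<open>Ident C D'\<close> and \<open>k\<close>.\<close>
  then have top: "is_pushout C v (v \<odot> k) E X (Ident C X) k"
    using van_kampen_mono[of z v, OF _ tM t(1) k z zM v(1)] po zv by simp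
  have idX: "Ident C X \<in> Hom C X X" using Ident_in_Hom Hom_Obj[OF k] by auto
  have idD: "Ident C D' \<in> Hom C D' D'" and idE: "Ident C E \<in> Hom C E E"
    using Ident_in_Hom Hom_Obj[OF v(1)] by auto
  have "Ident C D' \<odot> k = k \<odot> Ident C X"
    using Comp_Ident_left[OF k] Comp_Ident_right[OF k] by simp
  then obtain u where u: "u \<in> Hom C E D'" "Ident C D' = u \<odot> v" "k = u \<odot> (v \<odot> k)"
    using pushout_ex1[OF top idX k idD k] by blast
  have "v \<odot> u = Ident C E"
  proof (rule pushout_ext[OF top idX k Comp_in_Hom[OF u(1) v(1)] idE])
    show "(v \<odot> u) \<odot> v = Ident C E \<odot> v"
      using Comp_assoc[OF v(1) u(1) v(1)] u(2) Comp_Ident_left[OF v(1)] Comp_Ident_right[OF v(1)]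
      by simp
    show "(v \<odot> u) \<odot> (v \<odot> k) = Ident C E \<odot> (v \<odot> k)"
      using Comp_assoc[OF Comp_in_Hom[OF k v(1)] u(1) v(1)] u(3)
        Comp_Ident_left[OF Comp_in_Hom[OF k v(1)]] by simp
  qed
  note uv = u(2) this
  show ?thesis
  proof (rule is_limitI[OF p a0(1) aD(1) e' fe'])
    fix Y d s
    assume s: "s \<in> Hom C Y G'" and d: "\<And>a. a \<in> {1..p} \<Longrightarrow> d a \<in> Hom C Y (B a)"
      "\<And>a. a \<in> {1..p} \<Longrightarrow> f' a \<odot> d a = s"
    obtain w where w: "w \<in> Hom C Y E" "\<forall>a \<in> {1..p}. d a = c a \<odot> w"
      using limit_ex1[OF limE Hom_Obj(1)[OF s] d] by blast
    have vuw: "v \<odot> (u \<odot> w) = w"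
      using Comp_assoc[OF w(1) u(1) v(1)] uv(2) Comp_Ident_left[OF w(1)] by simp
    have "d a = e' a \<odot> (u \<odot> w)" if a: "a \<in> {1..p}" for a
      using w(2) a v(2) Comp_assoc[OF Comp_in_Hom[OF w(1) u(1)] v(1) lE(2)[OF a]] vuw by simp
    then show "\<exists>u. u \<in> Hom C Y D' \<and> (\<forall>a \<in> {1..p}. d a = e' a \<odot> u)"
      using Comp_in_Hom[OF w(1) u(1)] by blast
  next
    fix Y x y
    assume x: "x \<in> Hom C Y D'" and y: "y \<in> Hom C Y D'"
      and eq: "\<And>a. a \<in> {1..p} \<Longrightarrow> e' a \<odot> x = e' a \<odot> y"
    \<comment> \<open>The arrow \<open>\<phi>\<close> factors through each \<open>e' a\<close>, so
      its monicity gives uniqueness.\<close>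
    have "\<phi> \<in> M" using M_pushout[OF po tM] .
    moreover have "\<phi> \<odot> x = \<phi> \<odot> y"
      using eq[OF one] fe'[OF one] Comp_assoc[OF x e'[OF one] aD(1)[OF one]]
        Comp_assoc[OF y e'[OF one] aD(1)[OF one]] by simp
    ultimately show "x = y" using mono_cancel[OF M_mono a0(1) x y] by blast
  qed
qed

end

section \<open>The derived rule and the transport of the transformation\<close>

theorem theorem4p6:
  fixes C :: "('o, 'a) cat"
    and M :: "'a set"
    and \<R> :: "('o, 'a) weak_span set"
    and G H :: 'o
  assumes "adhesive_hlr C M"
    and "\<forall>\<rho> \<in> \<R>. is_M_weak_span C M \<rho>"
    and "G \<in> Obj C" and "H \<in> Obj C"
    and "pct_rel C \<R> G H"
  shows "\<exists>\<sigma> :: ('o, 'a) span. is_derived_rule C (pct_rel C \<R>) G H \<sigma>"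
proof -
  interpret adhesive_hlr C M by fact
  obtain \<Gamma> where \<Gamma>: "is_pc_diagram C \<R> G \<Gamma>"
    and PO: "\<forall>a \<in> {1..pcd_p \<Gamma>}. pcd_gamma \<Gamma> a \<in> Delta_PO C G \<R>"
    and pct: "is_pct C G \<Gamma> H"
    using assms(5) unfolding pct_rel_def by blast
  define p where "p = pcd_p \<Gamma>"
  define \<gamma> where "\<gamma> = pcd_gamma \<Gamma>"
  define j where "j = pcd_j \<Gamma>"
  define \<rho> where "\<rho> a = dt_rule (\<gamma> a)" for a
  define D where "D a = dt_D (\<gamma> a)" for a
  define f where "f a = dt_f (\<gamma> a)" for a
  define k where "k a = dt_k (\<gamma> a)" for a
  define m where "m a = dt_m (\<gamma> a)" for a
  note defs = p_def \<gamma>_def j_def \<rho>_def D_def f_def k_def m_def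
  have p: "1 \<le> p"
    using \<Gamma> unfolding is_pc_diagram_def Let_def defs by blast
  have one: "1 \<in> {1..p}" using p by simp
  have \<rho>R: "\<rho> a \<in> \<R>" if "a \<in> {1..p}" for a
    using \<Gamma> that unfolding is_pc_diagram_def Let_def defs by blast
  have j: "j a b \<in> Hom C (ws_I (\<rho> a)) (D b)"
    "j a a = k a \<odot>\<^bsub>C\<^esub> ws_i (\<rho> a)" if "a \<in> {1..p}" "b \<in> {1..p}" for a b
    using \<Gamma> that unfolding is_pc_diagram_def Let_def defs by blast+
  have \<rho>: "ws_l (\<rho> a) \<in> Hom C (ws_K (\<rho> a)) (ws_L (\<rho> a))"
    "ws_i (\<rho> a) \<in> Hom C (ws_I (\<rho> a)) (ws_K (\<rho> a))"
    "ws_r (\<rho> a) \<in> Hom C (ws_I (\<rho> a)) (ws_R (\<rho> a))"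
    "ws_l (\<rho> a) \<in> M" "ws_r (\<rho> a) \<in> M" if "a \<in> {1..p}" for a
    using assms(2) \<rho>R[OF that] unfolding is_M_weak_span_def is_weak_span_def by blast+
  have k: "k a \<in> Hom C (ws_K (\<rho> a)) (D a)" and f: "f a \<in> Hom C (D a) G"
    and m: "m a \<in> Hom C (ws_L (\<rho> a)) G"
    and poG: "is_pushout C (f a) (m a) G (ws_K (\<rho> a)) (ws_l (\<rho> a)) (k a)" if "a \<in> {1..p}" for a
    using PO that
    unfolding Delta_PO_def is_weak_double_pushout_def is_direct_transformation_def Let_def defs
    by blast+
  have fM: "f a \<in> M" if "a \<in> {1..p}" for a using M_pushout[OF poG[OF that] \<rho>(4)[OF that]] .
  from pct obtain X e d s q F h
    where lim: "is_limit C p D f G X e"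
      and d: "\<forall>c \<in> {1..p}. d c \<in> Hom C (ws_I (\<rho> c)) X \<and> (\<forall>a \<in> {1..p}. j c a = e a \<odot>\<^bsub>C\<^esub> d c)"
      and poF: "\<forall>a \<in> {1..p}. is_pushout C (s a) (q a) (F a) (ws_I (\<rho> a)) (ws_r (\<rho> a)) (d a)"
      and col: "is_colimit C p X s F h H"
    unfolding is_pct_def Let_def p_def[symmetric] \<gamma>_def[symmetric] j_def[symmetric]
      \<rho>_def[symmetric] D_def[symmetric] f_def[symmetric] by blast
  note l = limit_arrows[OF lim]
  note s = colimit_arrows(1)[OF col] and h = colimit_arrows(2)[OF col]
    and hs = colimit_arrows(3)[OF col _ one]
  have sM: "s a \<in> M" if "a \<in> {1..p}" for a using M_pushout poF \<rho>(5) that by blast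
  define t where "t = f 1 \<odot>\<^bsub>C\<^esub> e 1"
  define y where "y = h 1 \<odot>\<^bsub>C\<^esub> s 1"
  have t: "t \<in> Hom C X G" unfolding t_def using Comp_in_Hom[OF l(2,1)] one by blast
  have fe: "f a \<odot>\<^bsub>C\<^esub> e a = t" if "a \<in> {1..p}" for a unfolding t_def using l(3)[OF that one] .
  have feM: "f a \<odot>\<^bsub>C\<^esub> e a \<in> M" if "a \<in> {1..p}" for a using limit_in_M[OF lim p fM that] .
  \<comment> \<open>Decomposition puts the projections into \<open>M\<close>; this is what makes the
    pushouts \<open>B a\<close> exist.\<close>
  have eM: "e a \<in> M" if "a \<in> {1..p}" for a
    using M_decomp[OF l(2)[OF that] l(1)[OF that] feM[OF that] fM[OF that]] .
  have y: "y \<in> Hom C X H" unfolding y_def using Comp_in_Hom[OF s h] one by blast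
  \<comment> \<open>The legs are the diagonals of the limit and of the colimit: the common
    composites \<open>t\<close> and \<open>y\<close>.\<close>
  define \<sigma> :: "('o, 'a) span" where "\<sigma> = \<lparr>sp_L = G, sp_K = X, sp_R = H, sp_l = t, sp_r = y\<rparr>"
  have "is_derived_rule C (pct_rel C \<R>) G H \<sigma>"
    unfolding is_derived_rule_def
  proof (intro conjI ballI impI)
    show "is_span C \<sigma>" unfolding is_span_def \<sigma>_def using t y by simp
    \<comment> \<open>The rule applies to its own left-hand side, with \<open>X\<close> as pushout
      complement and with identities as the vertical arrows.\<close>
    show "dpo_rel C \<sigma> G H"
      unfolding dpo_rel_def \<sigma>_def span.simps
      using pushout_Ident_right[OF t] pushout_Ident_right[OF y] t y
        Ident_in_Hom[OF Hom_Obj(1)[OF t]] Ident_in_Hom[OF assms(3)] Ident_in_Hom[OF assms(4)]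
      by blast
  next
    fix G' H'
    assume "dpo_rel C \<sigma> G' H'"
    then obtain D' m0 k0 n0 \<phi> \<psi> where k0: "k0 \<in> Hom C X D'"
      and po1: "is_pushout C \<phi> m0 G' X t k0" and po2: "is_pushout C \<psi> n0 H' X y k0"
      unfolding dpo_rel_def \<sigma>_def span.simps by blast
    note a0 = pushout_arrows[OF po1 t k0]
    have "\<exists>e' \<delta> B. is_pushout C e' \<delta> B X (e a) k0" if "a \<in> {1..p}" for a
      using pushout_exists[OF l(2)[OF that] k0 eM[OF that]] .
    then obtain e' \<delta> B where poB: "\<And>a. a \<in> {1..p} \<Longrightarrow> is_pushout C (e' a) (\<delta> a) (B a) X (e a) k0"
      by metis
    have aB: "e' a \<in> Hom C D' (B a)" "\<delta> a \<in> Hom C (D a) (B a)"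
      "e' a \<odot>\<^bsub>C\<^esub> k0 = \<delta> a \<odot>\<^bsub>C\<^esub> e a" if a: "a \<in> {1..p}" for a
      using pushout_arrows[OF poB[OF a] l(2)[OF a] k0] by auto
    have "\<exists>w. w \<in> Hom C (B a) G' \<and> \<phi> = w \<odot>\<^bsub>C\<^esub> e' a \<and> m0 \<odot>\<^bsub>C\<^esub> f a = w \<odot>\<^bsub>C\<^esub> \<delta> a"
      if a: "a \<in> {1..p}" for a
    proof -
      have "\<phi> \<odot>\<^bsub>C\<^esub> k0 = (m0 \<odot>\<^bsub>C\<^esub> f a) \<odot>\<^bsub>C\<^esub> e a"
        using a0(3) fe[OF a] Comp_assoc[OF l(2)[OF a] f[OF a] a0(2)] by simp
      then show ?thesis
        using pushout_ex1[OF poB[OF a] l(2)[OF a] k0 a0(1) Comp_in_Hom[OF f[OF a] a0(2)]] by blast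
    qed
    then obtain f' where f': "\<And>a. a \<in> {1..p} \<Longrightarrow> f' a \<in> Hom C (B a) G'"
      "\<And>a. a \<in> {1..p} \<Longrightarrow> f' a \<odot>\<^bsub>C\<^esub> e' a = \<phi>"
      "\<And>a. a \<in> {1..p} \<Longrightarrow> f' a \<odot>\<^bsub>C\<^esub> \<delta> a = m0 \<odot>\<^bsub>C\<^esub> f a" by metis
    \<comment> \<open>The square at \<open>G'\<close> is a pushout over
      \<open>t = f a \<odot> e a\<close>, and cancelling the square at \<open>B a\<close> leaves the
      one over \<open>f a\<close>.\<close>
    have poD: "is_pushout C (f' a) m0 G' (D a) (f a) (\<delta> a)" if a: "a \<in> {1..p}" for a
      using pushout_decomp[OF poB[OF a] _ l(2)[OF a] f[OF a] k0 f'(1)[OF a] f'(2)[OF a] f'(3)[OF a]]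
        po1 fe[OF a] by simp
    have lim': "is_limit C p B f' G' D' e'"
      using limit_pushout[OF lim p fM t fe k0 po1 aB(2) poD aB(1) f'(2)] by blast
    have "\<exists>s' \<theta> F'. is_pushout C s' \<theta> F' X (s a) k0" if "a \<in> {1..p}" for a
      using pushout_exists[OF s[OF that] k0 sM[OF that]] .
    then obtain s' \<theta> F' where poF': "\<And>a. a \<in> {1..p} \<Longrightarrow> is_pushout C (s' a) (\<theta> a) (F' a) X (s a) k0"
      by metis
    \<comment> \<open>\<open>H'\<close> is the pushout of \<open>H\<close> along \<open>k0\<close>,
      hence the colimit of the pushed out legs.\<close>
    obtain h' where col': "is_colimit C p D' s' F' h' H'"
      using colimit_pushout[OF col p y _ k0 po2 poF'] hs unfolding y_def by blast
    have poI: "is_pushout C (s' a) (\<theta> a \<odot>\<^bsub>C\<^esub> q a) (F' a) (ws_I (\<rho> a)) (ws_r (\<rho> a)) (k0 \<odot>\<^bsub>C\<^esub> d a)"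
      if a: "a \<in> {1..p}" for a
      using pushout_comp[OF _ poF'[OF a] \<rho>(3)[OF a] _ k0] poF d a by blast
    have dk: "\<delta> a \<odot>\<^bsub>C\<^esub> k a \<in> Hom C (ws_K (\<rho> a)) (B a)"
      and dki: "\<delta> a \<odot>\<^bsub>C\<^esub> k a \<odot>\<^bsub>C\<^esub> ws_i (\<rho> a) \<in> Hom C (ws_I (\<rho> a)) (B a)"
      and mm: "m0 \<odot>\<^bsub>C\<^esub> m a \<in> Hom C (ws_L (\<rho> a)) G'"
      if a: "a \<in> {1..p}" for a
      using Comp_in_Hom[OF k[OF a] aB(2)[OF a]] Comp_in_Hom[OF \<rho>(2)[OF a]]
        Comp_in_Hom[OF m[OF a] a0(2)] by blast+
    \<comment> \<open>A direct transformation carries its own result object, so one is chosen for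
      each new \<open>D\<close>-object \<open>B a\<close>.\<close>
    have "\<exists>g n H0. is_pushout C g n H0 (ws_I (\<rho> a)) (ws_r (\<rho> a)) (\<delta> a \<odot>\<^bsub>C\<^esub> k a \<odot>\<^bsub>C\<^esub> ws_i (\<rho> a))"
      if a: "a \<in> {1..p}" for a
      using pushout_exists[OF \<rho>(3)[OF a] dki[OF a] \<rho>(5)[OF a]] .
    then obtain g n H0 where poH: "\<And>a. a \<in> {1..p} \<Longrightarrow>
        is_pushout C (g a) (n a) (H0 a) (ws_I (\<rho> a)) (ws_r (\<rho> a)) (\<delta> a \<odot>\<^bsub>C\<^esub> k a \<odot>\<^bsub>C\<^esub> ws_i (\<rho> a))"
      by metis
    have poG': "is_pushout C (f' a) (m0 \<odot>\<^bsub>C\<^esub> m a) G' (ws_K (\<rho> a)) (ws_l (\<rho> a)) (\<delta> a \<odot>\<^bsub>C\<^esub> k a)"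
      if a: "a \<in> {1..p}" for a
      using pushout_comp[OF poG[OF a] poD[OF a] \<rho>(1)[OF a] k[OF a] aB(2)[OF a]] .
    define \<gamma>' where "\<gamma>' a = \<lparr>dt_rule = \<rho> a, dt_D = B a, dt_H = H0 a, dt_m = m0 \<odot>\<^bsub>C\<^esub> m a,
      dt_k = \<delta> a \<odot>\<^bsub>C\<^esub> k a, dt_f = f' a, dt_g = g a, dt_n = n a\<rparr>" for a
    \<comment> \<open>The coherence arrows into \<open>D b\<close> are carried into
      \<open>B b\<close> by \<open>\<delta> b\<close>.\<close>
    define \<Gamma>' where "\<Gamma>' = \<lparr>pcd_p = p, pcd_gamma = \<gamma>', pcd_j = (\<lambda>a b. \<delta> b \<odot>\<^bsub>C\<^esub> j a b)\<rparr>"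
    have wdp: "is_weak_double_pushout C G' (\<gamma>' a)" if a: "a \<in> {1..p}" for a
      unfolding is_weak_double_pushout_def is_direct_transformation_def is_weak_span_def Let_def
        \<gamma>'_def direct_transformation.simps
      using \<rho>[OF a] dk[OF a] mm[OF a] f'(1)[OF a] poH[OF a] poG'[OF a]
        pushout_arrows[OF poH[OF a] \<rho>(3)[OF a] dki[OF a]]
        pushout_arrows[OF poG'[OF a] \<rho>(1)[OF a] dk[OF a]] by blast
    \<comment> \<open>The new arrows into the limit \<open>D'\<close> are
      \<open>k0 \<odot> d a\<close>, by commutation of the square at \<open>B b\<close>.\<close>
    have dj: "\<delta> b \<odot>\<^bsub>C\<^esub> j a b = e' b \<odot>\<^bsub>C\<^esub> (k0 \<odot>\<^bsub>C\<^esub> d a)" if a: "a \<in> {1..p}" and b: "b \<in> {1..p}" for a b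
    proof -
      have da: "d a \<in> Hom C (ws_I (\<rho> a)) X" "j a b = e b \<odot>\<^bsub>C\<^esub> d a" using d a b by blast+
      show ?thesis
        using da(2) Comp_assoc[OF da(1) l(2)[OF b] aB(2)[OF b]] Comp_assoc[OF da(1) k0 aB(1)[OF b]]
          aB(3)[OF b] by simp
    qed
    \<comment> \<open>Since \<open>\<odot>\<close> associates to the left, the right-hand side is
      the new arrow \<open>\<delta> a \<odot> k a\<close> after \<open>ws_i\<close>, as required on
      the diagonal.\<close>
    have djk: "\<delta> a \<odot>\<^bsub>C\<^esub> j a a = \<delta> a \<odot>\<^bsub>C\<^esub> k a \<odot>\<^bsub>C\<^esub> ws_i (\<rho> a)" if a: "a \<in> {1..p}" for a
      using j(2)[OF a a] Comp_assoc[OF \<rho>(2)[OF a] k[OF a] aB(2)[OF a]] by simp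
    \<comment> \<open>The right-hand side does not depend on \<open>b\<close>; comparing
      \<open>b\<close> with \<open>a\<close> yields the coherence of the new diagram.\<close>
    have fdj: "f' b \<odot>\<^bsub>C\<^esub> (\<delta> b \<odot>\<^bsub>C\<^esub> j a b) = \<phi> \<odot>\<^bsub>C\<^esub> (k0 \<odot>\<^bsub>C\<^esub> d a)"
      if a: "a \<in> {1..p}" and b: "b \<in> {1..p}" for a b
      using dj[OF a b] Comp_assoc[OF Comp_in_Hom[OF _ k0] aB(1)[OF b] f'(1)[OF b]] d a f'(2)[OF b]
      by metis
    have fdk: "f' b \<odot>\<^bsub>C\<^esub> (\<delta> b \<odot>\<^bsub>C\<^esub> j a b) = f' a \<odot>\<^bsub>C\<^esub> (\<delta> a \<odot>\<^bsub>C\<^esub> k a) \<odot>\<^bsub>C\<^esub> ws_i (\<rho> a)"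
      if a: "a \<in> {1..p}" and b: "b \<in> {1..p}" for a b
      using fdj[OF a b] fdj[OF a a] djk[OF a] Comp_assoc[OF \<rho>(2)[OF a] dk[OF a] f'(1)[OF a]] by simp
    have "is_pc_diagram C \<R> G' \<Gamma>'"
      unfolding is_pc_diagram_def Let_def \<Gamma>'_def pc_diagram.simps
    proof (intro conjI ballI)
      fix a assume a: "a \<in> {1..p}"
      show "dt_rule (\<gamma>' a) \<in> \<R>" using \<rho>R[OF a] by (simp add: \<gamma>'_def)
      show "is_direct_transformation C G' (\<gamma>' a)"
        using wdp[OF a] unfolding is_weak_double_pushout_def by blast
    qed (use p fdk djk Comp_in_Hom[OF j(1) aB(2)] in \<open>auto simp: \<gamma>'_def\<close>)
    moreover have "\<forall>a \<in> {1..pcd_p \<Gamma>'}. pcd_gamma \<Gamma>' a \<in> Delta_PO C G' \<R>"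
      using wdp \<rho>R by (simp add: Delta_PO_def \<Gamma>'_def \<gamma>'_def)
    moreover have "is_pct C G' \<Gamma>' H'"
      unfolding is_pct_def Let_def \<Gamma>'_def \<gamma>'_def pc_diagram.simps direct_transformation.simps
    proof (intro exI conjI)
      show "is_limit C p B f' G' D' e'" by (rule lim')
      show "is_colimit C p D' s' F' h' H'" by (rule col')
      show "\<forall>a \<in> {1..p}. is_pushout C (s' a) (\<theta> a \<odot>\<^bsub>C\<^esub> q a) (F' a) (ws_I (\<rho> a)) (ws_r (\<rho> a))
          (k0 \<odot>\<^bsub>C\<^esub> d a)" using poI by blast
      show "\<forall>c \<in> {1..p}. k0 \<odot>\<^bsub>C\<^esub> d c \<in> Hom C (ws_I (\<rho> c)) D' \<and>
          (\<forall>a \<in> {1..p}. \<delta> a \<odot>\<^bsub>C\<^esub> j c a = e' a \<odot>\<^bsub>C\<^esub> (k0 \<odot>\<^bsub>C\<^esub> d c))"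
        using dj d Comp_in_Hom[OF _ k0] by blast
    qed
    ultimately show "pct_rel C \<R> G' H'" unfolding pct_rel_def by blast
  qed
  then show ?thesis by blast
qed

end
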